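(* Let $\alpha,\beta,\delta\in\mathbb{C}$ with $\alpha\beta\delta\neq0$ and $\alpha^2\neq\beta^2$. Let $\varphi:(x,y)\mapsto(\bar x,\bar y)$ be the birational map of $\mathbb{P}^1\times\mathbb{P}^1$ $$\bar x=\frac{\delta^2\alpha\beta(\beta-\alpha)-\alpha x(x+y)+\beta x(x-y)}{\alpha(x+y)+\beta(x-y)},\qquad \bar y=x .$$ Then: (i) for every $n\ge1$ the degree of the $n$-th iterate $\varphi^n$ in the initial data is $2n$; (ii) the map $(x,y)\mapsto(v,w)$ given by $$v=\frac{\delta^2(\alpha^2+\beta^2)-2(x^2+y^2)}{\alpha^2(x+y)^2-\beta^2(x-y)^2},\qquad w=\frac{y+\frac{\delta(\alpha+\beta)}{2}}{x-\frac{\delta(\alpha-\beta)}{2}}$$ is birational and transforms $\varphi$ into the following pair of discrete Riccati equations, which can be solved in cascade: $$\bar v=\frac{\alpha^2-\beta^2-2\alpha^2\beta^2v}{\alpha^2\beta^2\big((\alpha^2-\beta^2)v+2\big)},\qquad \bar w=\frac{f_1vw+f_{2,+}v+f_3w+f_4}{-f_1vw-f_{2,-}v-f_3w+f_4},$$ where $f_1=\alpha(\alpha^2-\beta^2)$, $f_{2,\pm}=\alpha(\alpha\pm\beta)^2$, $f_3=2\alpha$, $f_4=2\beta$, and $\bar v,\bar w$ denote $v,w$ evaluated at $(\bar x,\bar y)=\varphi(x,y)$.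
   Context: The map $\varphi$ is the system form ($x=\bar u$, $y=u$) of the second-order equation $\alpha(u+\bar u)(\bar u+\bar{\bar u})+\beta(u-\bar u)(\bar u-\bar{\bar u})+\delta^2\alpha\beta(\alpha-\beta)=0$, which is the reduction $\hat u=-\bar u$ of the lattice equation $Q1_\delta$: $\alpha(u-\hat u)(\bar u-\hat{\bar u})-\beta(u-\bar u)(\hat u-\hat{\bar u})+\delta^2\alpha\beta(\alpha-\beta)=0$ (the reduction $\hat u=a-\bar u$ is brought to this one by the shift $u\mapsto u+a/2$). Degree convention: writing $(x_n,y_n)=\varphi^n(x_0,y_0)$, the degree of $\varphi^n$ in the initial data is the maximum of the degrees of $x_n$ and $y_n$ as rational functions of $x_0$ (for generic fixed $y_0$) and as rational functions of $y_0$ (for generic fixed $x_0$), where the degree of a rational function of one variable is the maximum of the degrees of its coprime numerator and denominator. A discrete Riccati equation is a first-order recursion in which the new value is a Möbius function of the old value (coefficients may depend on other, already determined, quantities); "solved in cascade" means that the first equation involves only $v$ and the second is Riccati in $w$ with coefficients depending on $v$.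
   Formalization: Part (ii) is proved under the additional assumption α²+β²≠0; when α²+β²=0 the function v is the constant −1/α², so (v,w) is not birational and both displayed Riccati equations become 0/0. *)

theory Defs
  imports
    Complex_Main
    "HOL-Computational_Algebra.Computational_Algebra"
    "HOL-Computational_Algebra.Field_as_Ring"
begin

section \<open>Rational functions and rational maps in two variables\<close>

text \<open>
  The polynomial ring in two variables is realised as \<^typ>\<open>complex poly poly\<close>: the inner
  variable is the first coordinate, the outer variable is the second one. Its fraction field
  is the function field of the affine plane, equivalently of the product of two projective lines.
\<close>

type_synonym ratfun1 = "complex poly fract"
type_synonym ratfun2 = "complex poly poly fract"

text \<open>
  A rational map from the product of two projective lines to itself, neither of whose components
  is identically infinite, is the same as the pair of its components in affine coordinates.
\<close>

type_synonym ratmap = "ratfun2 \<times> ratfun2"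

definition rconst :: "complex \<Rightarrow> ratfun2" where
  "rconst c = Fract [:[:c:]:] 1"

definition coord1 :: ratfun2 where
  "coord1 = Fract [:[:0, 1:]:] 1"

definition coord2 :: ratfun2 where
  "coord2 = Fract [:0, 1:] 1"

definition eval2 :: "complex poly poly \<Rightarrow> ratmap \<Rightarrow> ratfun2" where
  "eval2 p G = poly (map_poly (\<lambda>r. poly (map_poly rconst r) (fst G)) p) (snd G)"

text \<open>
  Substitution of the components of \<open>G\<close> into a rational function \<open>f\<close>. It takes the junk value 0
  if the denominator of \<open>f\<close> vanishes identically after the substitution; this never happens if
  \<open>G\<close> is dominant, in particular if \<open>G\<close> is birational.
\<close>

definition rsubst :: "ratfun2 \<Rightarrow> ratmap \<Rightarrow> ratfun2" where
  "rsubst f G = eval2 (fst (quot_of_fract f)) G / eval2 (snd (quot_of_fract f)) G"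

definition ratmap_id :: ratmap where
  "ratmap_id = (coord1, coord2)"

definition ratmap_comp :: "ratmap \<Rightarrow> ratmap \<Rightarrow> ratmap" where
  "ratmap_comp F G = (rsubst (fst F) G, rsubst (snd F) G)"

definition ratmap_iter :: "ratmap \<Rightarrow> nat \<Rightarrow> ratmap" where
  "ratmap_iter F n = (ratmap_comp F ^^ n) ratmap_id"

text \<open>
  Both coordinates are nonzero, so the two equations below can only hold if all the substitutions
  involved are defined.
\<close>

definition birational :: "ratmap \<Rightarrow> bool" where
  "birational F \<longleftrightarrow>
     (\<exists>G. ratmap_comp G F = ratmap_id \<and> ratmap_comp F G = ratmap_id)"


section \<open>Degrees\<close>

text \<open>\<^const>\<open>quot_of_fract\<close> returns a coprime pair of numerator and denominator.\<close>

definition ratfun1_degree :: "ratfun1 \<Rightarrow> nat" where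
  "ratfun1_degree f = max (degree (fst (quot_of_fract f))) (degree (snd (quot_of_fract f)))"

text \<open>
  The restrictions of a rational function to a line on which the second, respectively the first,
  coordinate is fixed to \<open>c\<close>. The denominator restricts to the zero polynomial for only finitely
  many \<open>c\<close>.
\<close>

definition restrict_fst :: "ratfun2 \<Rightarrow> complex \<Rightarrow> ratfun1" where
  "restrict_fst f c =
     Fract (poly (fst (quot_of_fract f)) [:c:]) (poly (snd (quot_of_fract f)) [:c:])"

definition restrict_snd :: "ratfun2 \<Rightarrow> complex \<Rightarrow> ratfun1" where
  "restrict_snd f c =
     Fract (map_poly (\<lambda>r. poly r c) (fst (quot_of_fract f)))
           (map_poly (\<lambda>r. poly r c) (snd (quot_of_fract f)))"

text \<open>The value taken for all but finitely many parameters.\<close>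

definition generic_value :: "(complex \<Rightarrow> nat) \<Rightarrow> nat" where
  "generic_value g = (THE d. finite {c. g c \<noteq> d})"

definition degree_fst :: "ratfun2 \<Rightarrow> nat" where
  "degree_fst f = generic_value (\<lambda>c. ratfun1_degree (restrict_fst f c))"

definition degree_snd :: "ratfun2 \<Rightarrow> nat" where
  "degree_snd f = generic_value (\<lambda>c. ratfun1_degree (restrict_snd f c))"

definition ratmap_degree :: "ratmap \<Rightarrow> nat" where
  "ratmap_degree F =
     Max {degree_fst (fst F), degree_fst (snd F), degree_snd (fst F), degree_snd (snd F)}"


section \<open>Discrete Riccati equations solvable in cascade\<close>

text \<open>
  In the coordinates \<open>(v, w)\<close>, the first component is a Moebius function of \<open>v\<close> with constant
  coefficients, and the second one is a Moebius function of \<open>w\<close> whose coefficients are rational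
  functions of \<open>v\<close>; clearing denominators, these may be taken to be polynomials in \<open>v\<close>.
\<close>

definition riccati_cascade :: "ratmap \<Rightarrow> bool" where
  "riccati_cascade F \<longleftrightarrow>
     (\<exists>a b c d :: complex. a * d - b * c \<noteq> 0 \<and>
        fst F = (rconst a * coord1 + rconst b) / (rconst c * coord1 + rconst d)) \<and>
     (\<exists>A B C D :: complex poly. A * D - B * C \<noteq> 0 \<and>
        snd F = (Fract [:A:] 1 * coord2 + Fract [:B:] 1) / (Fract [:C:] 1 * coord2 + Fract [:D:] 1))"


section \<open>The maps\<close>

definition phi_map :: "complex \<Rightarrow> complex \<Rightarrow> complex \<Rightarrow> ratmap" where
  "phi_map \<alpha> \<beta> \<delta> =
     (let x = coord1; y = coord2; a = rconst \<alpha>; b = rconst \<beta>; d = rconst \<delta>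
      in ((d^2 * a * b * (b - a) - a * x * (x + y) + b * x * (x - y))
            / (a * (x + y) + b * (x - y)),
          x))"

definition vw_map :: "complex \<Rightarrow> complex \<Rightarrow> complex \<Rightarrow> ratmap" where
  "vw_map \<alpha> \<beta> \<delta> =
     (let x = coord1; y = coord2; a = rconst \<alpha>; b = rconst \<beta>; d = rconst \<delta>
      in ((d^2 * (a^2 + b^2) - 2 * (x^2 + y^2)) / (a^2 * (x + y)^2 - b^2 * (x - y)^2),
          (y + d * (a + b) / 2) / (x - d * (a - b) / 2)))"

text \<open>The linearised system, as a map in the coordinates \<open>(v, w)\<close>.\<close>

definition riccati_map :: "complex \<Rightarrow> complex \<Rightarrow> ratmap" where
  "riccati_map \<alpha> \<beta> =
     (let v = coord1; w = coord2; a = rconst \<alpha>; b = rconst \<beta>;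
          f1 = a * (a^2 - b^2); f2p = a * (a + b)^2; f2m = a * (a - b)^2;
          f3 = 2 * a; f4 = 2 * b
      in ((a^2 - b^2 - 2 * a^2 * b^2 * v) / (a^2 * b^2 * ((a^2 - b^2) * v + 2)),
          (f1 * v * w + f2p * v + f3 * w + f4) / (- f1 * v * w - f2m * v - f3 * w + f4)))"


section \<open>The degenerate parameter values\<close>

text \<open>
  If \<open>\<alpha>\<^sup>2 + \<beta>\<^sup>2 = 0\<close>, then the component \<open>v\<close> is constant and \<open>(v, w)\<close> are not coordinates.
\<close>

lemma rconst_simps:
  "rconst (a + b) = rconst a + rconst b" "rconst (a - b) = rconst a - rconst b"
  "rconst (a * b) = rconst a * rconst b" "rconst (- a) = - rconst a"
  "rconst 0 = 0" "rconst 1 = 1" "rconst (a ^ n) = rconst a ^ n"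
proof -
  show mult: "rconst (a * b) = rconst a * rconst b" for a b by (simp add: rconst_def)
  show one: "rconst 1 = 1" by (simp add: rconst_def One_fract_def one_pCons)
  show "rconst (a ^ n) = rconst a ^ n" by (induction n) (simp_all add: mult one)
qed (simp_all add: rconst_def Zero_fract_def)

lemma rconst_eq_0_iff [simp]: "rconst c = 0 \<longleftrightarrow> c = 0"
  by (simp add: rconst_def Zero_fract_def eq_fract)

lemma rsubst_rconst: "rsubst (rconst c) G = rconst c"
proof -
  have "snd (quot_of_fract (rconst c)) = 1"
    by (simp add: rconst_def snd_quot_of_fract_Fract_whole)
  moreover have "fst (quot_of_fract (rconst c)) = [:[:c:]:]"
    using Fract_quot_of_fract [of "rconst c"]
    unfolding calculation by (simp add: rconst_def eq_fract)
  ultimately show ?thesis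
    by (simp add: rsubst_def eval2_def map_poly_pCons rconst_simps one_pCons)
qed

lemma coord1_neq_rconst: "coord1 \<noteq> rconst c"
  by (simp add: coord1_def rconst_def eq_fract)

lemma vw_map_degenerate:
  assumes "\<alpha> \<noteq> 0" and "\<alpha>^2 + \<beta>^2 = 0"
  shows "fst (vw_map \<alpha> \<beta> \<delta>) = rconst (- 1 / \<alpha>^2)"
    and "\<not> birational (vw_map \<alpha> \<beta> \<delta>)"
proof -
  let ?a = "rconst \<alpha>" and ?b = "rconst \<beta>" and ?s = "coord1 ^ 2 + coord2 ^ 2"
  have ab: "?b ^ 2 = - (?a ^ 2)"
    using arg_cong [OF assms(2), of rconst] by (simp add: rconst_simps eq_neg_iff_add_eq_0 add.commute)
  have s: "?s \<noteq> 0"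
    by (simp add: coord1_def coord2_def power2_eq_square Zero_fract_def eq_fract)
  have two: "(2 :: ratfun2) \<noteq> 0"
  proof -
    have "(2 :: ratfun2) = rconst 2"
      using rconst_simps(1) [of 1 1] by (simp add: rconst_simps)
    then show ?thesis by (metis rconst_eq_0_iff zero_neq_numeral)
  qed
  have a: "?a \<noteq> 0" using assms(1) by simp
  have inv: "rconst (- 1 / \<alpha>^2) * ?a ^ 2 = - 1"
    using assms(1) by (simp flip: rconst_simps)
  have den: "?a ^ 2 * (coord1 + coord2) ^ 2 - ?b ^ 2 * (coord1 - coord2) ^ 2 = 2 * ?a ^ 2 * ?s"
    unfolding ab by (simp add: power2_eq_square algebra_simps)
  have "fst (vw_map \<alpha> \<beta> \<delta>) = (- 2 * ?s) / (2 * ?a ^ 2 * ?s)"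
    unfolding vw_map_def Let_def fst_conv den by (simp add: ab)
  also have "\<dots> = - 1 / ?a ^ 2"
  proof -
    have "(- 2 * t) / (2 * A * t) = - 1 / A" if "t \<noteq> 0" "A \<noteq> 0" for t A :: ratfun2
      using that two by (simp add: divide_simps)
    from this [OF s, of "?a ^ 2"] show ?thesis using a by (simp only: power_not_zero not_False_eq_True)
  qed
  also have "\<dots> = rconst (- 1 / \<alpha>^2)"
    using inv a by (simp add: field_simps)
  finally show v: "fst (vw_map \<alpha> \<beta> \<delta>) = rconst (- 1 / \<alpha>^2)" .
  show "\<not> birational (vw_map \<alpha> \<beta> \<delta>)"
    using coord1_neq_rconst
    by (auto simp: birational_def ratmap_comp_def ratmap_id_def v rsubst_rconst) metis
qed

end

(*
  Put a = delta (alpha - beta) / 2, b = delta (alpha + beta) / 2, k = b^2 - a^2. An orbit u_n satisfies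
  u_{n+1} (b u_n + a u_{n-1}) = - (a u_n^2 + b u_n u_{n-1} + a k). The quantity
    p_n = k (u_n u_{n-1} + a b) / ((a u_n + b u_{n-1}) (b u_n + a u_{n-1}))
  satisfies p_n p_{n+1} = 1, and the recurrence becomes linear with coefficients in p_0:
    b u_{n+1} + a u_n = - p_n (a u_n + b u_{n-1}).
  Hence u_{n+2} = T u_n - u_{n-2} with T a rational function of p_0 + 1/p_0. This gives numerators and
  denominators of u_n recursively. Their degrees can be read off, and they have no common zeros
  except at points with both coordinates in {a, -a, b, -b}, so the degrees do not drop.

  For fixed v the points (x, y) form a conic through the base point (a, -b) of the map, and w is the
  slope of the line joining (x, y) to this base point; so (v, w) are coordinates. If a^2 + b^2 = 0 then v is
  constant, whereas p_0 still makes sense; this is why the degrees are computed with p_0.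
*)

theory Submission
  imports Defs
begin

section \<open>Substitution into rational functions and their values at points\<close>

section \<open>Substitution\<close>

lemma poly_map_poly_add:
  fixes h :: "'a::comm_ring_1 \<Rightarrow> 'b::comm_ring_1"
  assumes "h 0 = 0" and "\<And>a b. h (a + b) = h a + h b"
  shows "poly (map_poly h (p + q)) x = poly (map_poly h p) x + poly (map_poly h q) x"
proof (induction p arbitrary: q)
  case (pCons a p)
  then show ?case
    by (cases q) (simp add: map_poly_pCons assms algebra_simps)
qed simp

lemma poly_map_poly_mult:
  fixes h :: "'a::comm_ring_1 \<Rightarrow> 'b::comm_ring_1"
  assumes "h 0 = 0" and "\<And>a b. h (a + b) = h a + h b" and "\<And>a b. h (a * b) = h a * h b"
  shows "poly (map_poly h (p * q)) x = poly (map_poly h p) x * poly (map_poly h q) x"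
proof (induction p)
  case (pCons a p)
  have "poly (map_poly h (smult a q)) x = h a * poly (map_poly h q) x"
    by (induction q) (simp_all add: map_poly_pCons assms algebra_simps)
  with pCons show ?case
    by (simp add: map_poly_pCons poly_map_poly_add assms algebra_simps)
qed simp

lemma eval2_add: "eval2 (p + q) G = eval2 p G + eval2 q G"
  unfolding eval2_def
  by (rule poly_map_poly_add) (simp_all add: poly_map_poly_add rconst_simps)

lemma eval2_mult: "eval2 (p * q) G = eval2 p G * eval2 q G"
  unfolding eval2_def
  by (rule poly_map_poly_mult)
     (simp_all add: poly_map_poly_add poly_map_poly_mult rconst_simps)

definition pconst :: "complex \<Rightarrow> complex poly poly" where "pconst c = [:[:c:]:]"
definition px :: "complex poly poly" where "px = [:[:0, 1:]:]"
definition py :: "complex poly poly" where "py = [:0, 1:]"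

lemma eval2_pconst: "eval2 (pconst c) G = rconst c"
  by (simp add: eval2_def pconst_def map_poly_pCons rconst_simps)

lemma eval2_px: "eval2 px G = fst G"
  by (simp add: eval2_def px_def map_poly_pCons rconst_simps)

lemma eval2_py: "eval2 py G = snd G"
  by (simp add: eval2_def py_def map_poly_pCons rconst_simps one_pCons)

lemma eval2_1: "eval2 1 G = 1"
  using eval2_pconst [of 1 G] by (simp add: pconst_def rconst_simps flip: one_pCons)

lemma to_fract_pconst: "to_fract (pconst c) = rconst c"
  by (simp add: to_fract_def pconst_def rconst_def)

lemma to_fract_px: "to_fract px = coord1"
  by (simp add: to_fract_def px_def coord1_def)

lemma to_fract_py: "to_fract py = coord2"
  by (simp add: to_fract_def py_def coord2_def)

lemma to_fract_power: "to_fract (p ^ n) = to_fract p ^ n"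
  by (induction n) simp_all

lemmas to_fract_simps =
  to_fract_add to_fract_diff to_fract_mult to_fract_uminus to_fract_power to_fract_1
  to_fract_pconst to_fract_px to_fract_py

text \<open>Both pairs represent the same fraction. Later arguments use this relation and
  coprimality, whichever reduced pair \<open>quot_of_fract\<close> picks.\<close>

lemma quot_of_fract_proportional:
  assumes "q \<noteq> (0 :: complex poly poly)"
  shows "fst (quot_of_fract (to_fract p / to_fract q)) * q
           = p * snd (quot_of_fract (to_fract p / to_fract q))"
proof -
  let ?f = "to_fract p / to_fract q"
  have "Fract (fst (quot_of_fract ?f)) (snd (quot_of_fract ?f)) = Fract p q"
    by (simp only: Fract_quot_of_fract) (simp add: Fract_conv_to_fract)
  then show ?thesis
    using assms by (simp only: eq_fract(1) snd_quot_of_fract_nonzero not_False_eq_True)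
qed

text \<open>
  A ring homomorphism from polynomials to a field extends to those fractions that can be written with
  a denominator outside the kernel. The homomorphisms of interest are evaluation at a point and
  substitution of a rational map.
\<close>

locale fraction_hom =
  fixes h :: "complex poly poly \<Rightarrow> 'f::field"
  assumes hom_add: "h (p + q) = h p + h q" and hom_mult: "h (p * q) = h p * h q"
    and hom_1: "h 1 = 1"
begin

text \<open>As a relation it has introduction rules for all field operations, which
  \<open>intro\<close> applies along an explicit fraction, leaving side conditions only for the
  divisors.\<close>

definition maps_to :: "ratfun2 \<Rightarrow> 'f \<Rightarrow> bool" where
  "maps_to f c \<longleftrightarrow> (\<exists>p q. f = to_fract p / to_fract q \<and> h q \<noteq> 0 \<and> c = h p / h q)"

lemma maps_toI: "f = to_fract p / to_fract q \<Longrightarrow> h q \<noteq> 0 \<Longrightarrow> c = h p / h q \<Longrightarrow> maps_to f c"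
  unfolding maps_to_def by blast

lemma hom_0: "h 0 = 0"
  by (metis add.right_neutral add_left_cancel hom_add)

lemma maps_to_nonzero: "maps_to f c \<Longrightarrow> c \<noteq> 0 \<Longrightarrow> f \<noteq> 0"
  by (auto simp: maps_to_def hom_0)

lemma maps_to_rconst: "maps_to (rconst c) (h (pconst c))"
  by (rule maps_toI [where p = "pconst c" and q = 1]) (simp_all add: to_fract_simps hom_1)

lemma maps_to_coord1: "maps_to coord1 (h px)"
  by (rule maps_toI [where p = px and q = 1]) (simp_all add: to_fract_simps hom_1)

lemma maps_to_coord2: "maps_to coord2 (h py)"
  by (rule maps_toI [where p = py and q = 1]) (simp_all add: to_fract_simps hom_1)

lemma maps_to_add:
  assumes "maps_to f c" "maps_to g d"
  shows "maps_to (f + g) (c + d)"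
proof -
  obtain p q p' q' where f: "f = to_fract p / to_fract q" "h q \<noteq> 0" "c = h p / h q"
    and g: "g = to_fract p' / to_fract q'" "h q' \<noteq> 0" "d = h p' / h q'"
    using assms unfolding maps_to_def by blast
  have "q \<noteq> 0" "q' \<noteq> 0" using f g by (auto simp: hom_0)
  then show ?thesis using f g
    by (intro maps_toI [where p = "p * q' + p' * q" and q = "q * q'"])
       (simp_all add: hom_add hom_mult add_frac_eq)
qed

lemma maps_to_mult:
  assumes "maps_to f c" "maps_to g d"
  shows "maps_to (f * g) (c * d)"
proof -
  obtain p q p' q' where f: "f = to_fract p / to_fract q" "h q \<noteq> 0" "c = h p / h q"
    and g: "g = to_fract p' / to_fract q'" "h q' \<noteq> 0" "d = h p' / h q'"
    using assms unfolding maps_to_def by blast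
  then show ?thesis
    by (intro maps_toI [where p = "p * p'" and q = "q * q'"]) (simp_all add: hom_mult)
qed

lemma maps_to_1: "maps_to 1 1"
  by (rule maps_toI [where p = 1 and q = 1]) (simp_all add: hom_1)

lemma maps_to_uminus:
  assumes "maps_to f c"
  shows "maps_to (- f) (- c)"
proof -
  have "h (- 1) = - 1"
    using hom_add [of 1 "- 1"] by (simp add: hom_0 hom_1 eq_neg_iff_add_eq_0 add.commute)
  then have "maps_to (- 1) (- 1)"
    by (intro maps_toI [where p = "- 1" and q = 1]) (simp_all add: hom_1)
  from maps_to_mult [OF this assms] show ?thesis by simp
qed

lemma maps_to_diff: "maps_to f c \<Longrightarrow> maps_to g d \<Longrightarrow> maps_to (f - g) (c - d)"
  using maps_to_add [OF _ maps_to_uminus, of f c g d] by simp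

lemma maps_to_divide:
  assumes "maps_to f c" "maps_to g d" "d \<noteq> 0"
  shows "maps_to (f / g) (c / d)"
proof -
  obtain p q where "g = to_fract p / to_fract q" "h q \<noteq> 0" "d = h p / h q"
    using assms(2) unfolding maps_to_def by blast
  then have "maps_to (inverse g) (inverse d)"
    using assms(3) by (intro maps_toI [where p = q and q = p]) auto
  from maps_to_mult [OF assms(1) this] show ?thesis by (simp add: divide_inverse)
qed

lemma maps_to_power: "maps_to f c \<Longrightarrow> maps_to (f ^ n) (c ^ n)"
  by (induction n) (simp_all add: maps_to_1 maps_to_mult)

end

interpretation at_point: fraction_hom "\<lambda>p. poly (poly p [:t:]) s" for s t
  by standard simp_all

interpretation subst: fraction_hom "\<lambda>p. eval2 p G" for G
  by standard (simp_all add: eval2_add eval2_mult eval2_1)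

lemma at_point_rconst: "at_point.maps_to t s (rconst c) c"
  using at_point.maps_to_rconst [of t s c] by (simp add: pconst_def)

text \<open>Argument order: in \<open>at_point.maps_to t s\<close> the value \<open>t\<close> of the
  second coordinate comes first.\<close>

lemma at_point_coord1: "at_point.maps_to t s coord1 s"
  using at_point.maps_to_coord1 [of t s] by (simp add: px_def)

lemma at_point_coord2: "at_point.maps_to t s coord2 t"
  using at_point.maps_to_coord2 [of t s] by (simp add: py_def)

lemmas at_point_intros =
  at_point_rconst at_point_coord1 at_point_coord2 at_point.maps_to_add at_point.maps_to_diff
  at_point.maps_to_mult at_point.maps_to_uminus at_point.maps_to_divide at_point.maps_to_power
  at_point.maps_to_1

text \<open>Used to certify that an explicit denominator is not identically zero, by its value at
  one chosen point.\<close>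

lemma nonzero_if_nonzero_at:
  assumes "at_point.maps_to t s f c" and "c \<noteq> 0"
  shows "f \<noteq> 0"
  using assms by (rule at_point.maps_to_nonzero)

text \<open>The reduced denominator divides every other denominator \<open>q\<close> of
  \<open>f\<close>. Hence if some \<open>q\<close> survives the substitution, so does the reduced
  one, and the junk value of \<open>rsubst\<close> is avoided.\<close>

lemma rsubst_eqI:
  assumes "subst.maps_to G f g"
  shows "rsubst f G = g"
proof -
  obtain p q where f: "f = to_fract p / to_fract q" and q: "eval2 q G \<noteq> 0"
    and g: "g = eval2 p G / eval2 q G"
    using assms unfolding subst.maps_to_def by blast
  let ?n = "fst (quot_of_fract f)" and ?d = "snd (quot_of_fract f)"
  have q0: "q \<noteq> 0" using q by (auto simp: eval2_def)
  have prop_eq: "?n * q = p * ?d"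
    unfolding f using q0 by (rule quot_of_fract_proportional)
  have "?d dvd ?n * q"
    unfolding prop_eq by simp
  then have "?d dvd q"
    using coprime_quot_of_fract [of f] by (metis coprime_commute coprime_dvd_mult_right_iff)
  then obtain r where r: "q = ?d * r" by blast
  then have d: "eval2 ?d G \<noteq> 0"
    using q by (metis eval2_mult mult_zero_left)
  have "eval2 ?n G * eval2 q G = eval2 p G * eval2 ?d G"
    using prop_eq by (metis eval2_mult)
  then show ?thesis
    using d q by (simp add: rsubst_def g frac_eq_eq)
qed

lemma subst_rconst: "subst.maps_to G (rconst c) (rconst c)"
  using subst.maps_to_rconst by (simp add: eval2_pconst)

lemma subst_coord1: "subst.maps_to (f, g) coord1 f"
  using subst.maps_to_coord1 by (metis eval2_px fst_conv)

lemma subst_coord2: "subst.maps_to (f, g) coord2 g"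
  using subst.maps_to_coord2 by (metis eval2_py snd_conv)

lemmas subst_intros =
  subst_rconst subst_coord1 subst_coord2 subst.maps_to_add subst.maps_to_diff subst.maps_to_mult
  subst.maps_to_uminus subst.maps_to_divide subst.maps_to_power subst.maps_to_1

lemma rsubst_coord1: "rsubst coord1 (f, g) = f"
  by (rule rsubst_eqI) (rule subst_coord1)

lemma rsubst_coord2: "rsubst coord2 (f, g) = g"
  by (rule rsubst_eqI) (rule subst_coord2)

lemma rconst_divide: "rconst (a / b) = rconst a / rconst b"
proof (cases "b = 0")
  case False
  then have "rconst (a / b) * rconst b = rconst a"
    by (simp flip: rconst_simps)
  then show ?thesis using False by (simp add: eq_divide_eq)
qed (simp add: rconst_simps)

lemma rconst_numeral: "rconst (numeral k) = numeral k"
proof -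
  have "rconst (of_nat n) = of_nat n" for n
    by (induction n) (simp_all add: rconst_simps)
  from this [of "numeral k"] show ?thesis by simp
qed

lemma subst_numeral: "subst.maps_to G (numeral k) (numeral k)"
  using subst_rconst [of G "numeral k"] by (simp add: rconst_numeral)

lemma at_point_numeral: "at_point.maps_to t s (numeral k) (numeral k)"
  using at_point_rconst [of t s "numeral k"] by (simp add: rconst_numeral)

section \<open>Reading off generic degrees from a numerator and a denominator\<close>

section \<open>Degrees\<close>

lemma coprime_if_no_common_root:
  fixes p q :: "complex poly"
  assumes "q \<noteq> 0" and "\<And>z. poly q z = 0 \<Longrightarrow> poly p z \<noteq> 0"
  shows "coprime p q"
proof (rule coprimeI)
  fix r assume r: "r dvd p" "r dvd q"
  have "\<not> degree r > 0"
  proof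
    assume "degree r > 0"
    then obtain z where "poly r z = 0"
      using alg_closed_imp_poly_has_root by blast
    then have "poly p z = 0" "poly q z = 0"
      using r by (auto elim!: dvdE)
    then show False using assms(2) by blast
  qed
  moreover have "r \<noteq> 0" using r assms(1) by auto
  ultimately show "is_unit r" by (simp add: is_unit_iff_degree)
qed

text \<open>The denominators of two coprime representations divide each other.\<close>

lemma ratfun1_degree_Fract:
  assumes "coprime p q" and "q \<noteq> 0"
  shows "ratfun1_degree (Fract p q) = max (degree p) (degree q)"
proof -
  let ?f = "Fract p q"
  let ?n = "fst (quot_of_fract ?f)" and ?d = "snd (quot_of_fract ?f)"
  have eq: "?n * q = p * ?d"
    using Fract_quot_of_fract [of ?f] assms(2) eq_fract(1) [of ?d q ?n p] by simp
  have d0: "?d \<noteq> 0" by simp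
  have cop: "coprime ?n ?d" by (rule coprime_quot_of_fract)
  have "?d dvd q"
    using eq cop by (metis coprime_commute coprime_dvd_mult_right_iff dvd_triv_right)
  moreover have "q dvd ?d"
    using eq assms(1) by (metis coprime_commute coprime_dvd_mult_right_iff dvd_triv_right)
  ultimately have dq: "degree ?d = degree q"
    using d0 assms(2) by (meson dvd_imp_degree_le le_antisym)
  have "degree ?n = degree p"
  proof (cases "p = 0")
    case True
    then show ?thesis using eq assms(2) by simp
  next
    case False
    then have "?n \<noteq> 0" using eq d0 by auto
    then show ?thesis
      using arg_cong [OF eq, of degree] False assms(2) d0 dq by (simp add: degree_mult_eq)
  qed
  then show ?thesis by (simp add: ratfun1_degree_def dq)
qed

text \<open>Two cofinite sets of complex numbers meet, so the generic value is unique.\<close>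

lemma generic_value_eqI:
  assumes "finite A" and "\<And>c. c \<notin> A \<Longrightarrow> g c = d"
  shows "generic_value g = d"
  unfolding generic_value_def
proof (rule the_equality)
  show fin: "finite {c. g c \<noteq> d}"
    using assms by (auto intro: finite_subset [OF _ assms(1)])
  fix d' assume "finite {c. g c \<noteq> d'}"
  then have "finite ({c. g c \<noteq> d} \<union> {c. g c \<noteq> d'})" using fin by simp
  then have "{c. g c \<noteq> d} \<union> {c. g c \<noteq> d'} \<noteq> UNIV"
    using infinite_UNIV_char_0 by metis
  then show "d' = d" by auto
qed

lemma finite_zero_restrictions_fst:
  assumes "p \<noteq> (0 :: complex poly poly)"
  shows "finite {c. poly p [:c:] = 0}"
proof -
  have "finite {z. poly p z = 0}" using assms by (rule poly_roots_finite)
  then have "finite ((\<lambda>c. [:c:]) -` {z. poly p z = 0})"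
    by (rule finite_vimageI) (auto intro: injI)
  then show ?thesis by (simp add: vimage_def)
qed

lemma poly_map_poly_eval: "poly (map_poly (\<lambda>r. poly r c) p) t = poly (poly p [:t:]) (c :: complex)"
  by (induction p) (simp_all add: map_poly_pCons)

lemma map_poly_eval_mult:
  "map_poly (\<lambda>r. poly r c) (p * q) = map_poly (\<lambda>r. poly r c) p * map_poly (\<lambda>r. poly r (c::complex)) q"
  by (rule poly_ext) (simp add: poly_map_poly_eval)

text \<open>A drop is only possible where the leading coefficient, a polynomial in the first
  variable, vanishes.\<close>

lemma finite_degree_drop_snd:
  assumes "p \<noteq> (0 :: complex poly poly)"
  shows "finite {c. degree (map_poly (\<lambda>r. poly r c) p) \<noteq> degree p \<or> map_poly (\<lambda>r. poly r c) p = 0}"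
proof (rule finite_subset)
  show "finite {c. poly (lead_coeff p) c = 0}"
    using assms by (intro poly_roots_finite) simp
  have "degree (map_poly (\<lambda>r. poly r c) p) = degree p \<and> map_poly (\<lambda>r. poly r c) p \<noteq> 0"
    if "poly (lead_coeff p) c \<noteq> 0" for c
  proof -
    have "coeff (map_poly (\<lambda>r. poly r c) p) (degree p) \<noteq> 0"
      using that by (simp add: coeff_map_poly)
    then show ?thesis
      using map_poly_degree_leq [of "\<lambda>r. poly r c" p] le_degree by fastforce
  qed
  then show "{c. degree (map_poly (\<lambda>r. poly r c) p) \<noteq> degree p \<or> map_poly (\<lambda>r. poly r c) p = 0}
    \<subseteq> {c. poly (lead_coeff p) c = 0}" by blast
qed

text \<open>If the common zeros of \<open>p\<close> and \<open>q\<close> lie over finitely many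
  parameters, then elsewhere the restricted pair has no common root. It is then coprime over the
  complex numbers, so its degrees count without prior reduction.\<close>

lemma degree_fst_eq:
  assumes "q \<noteq> 0" and "finite A"
    and cop: "\<And>s t. poly (poly p [:t:]) s = 0 \<Longrightarrow> poly (poly q [:t:]) s = 0 \<Longrightarrow> t \<in> A"
    and deg: "\<And>t. max (degree (poly p [:t:])) (degree (poly q [:t:])) = d"
  shows "degree_fst (to_fract p / to_fract q) = d"
proof -
  let ?f = "to_fract p / to_fract q"
  let ?n = "fst (quot_of_fract ?f)" and ?d = "snd (quot_of_fract ?f)"
  have eq: "?n * q = p * ?d" using assms(1) by (rule quot_of_fract_proportional)
  show ?thesis
    unfolding degree_fst_def
  proof (rule generic_value_eqI)
    show "finite (A \<union> {c. poly q [:c:] = 0} \<union> {c. poly ?d [:c:] = 0})"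
      using assms(1,2) by (simp add: finite_zero_restrictions_fst)
    fix c assume c: "c \<notin> A \<union> {c. poly q [:c:] = 0} \<union> {c. poly ?d [:c:] = 0}"
    have "poly ?n [:c:] * poly q [:c:] = poly p [:c:] * poly ?d [:c:]"
      using arg_cong [OF eq, of "\<lambda>r. poly r [:c:]"] by simp
    then have "restrict_fst ?f c = Fract (poly p [:c:]) (poly q [:c:])"
      using c by (simp add: restrict_fst_def eq_fract)
    moreover have "coprime (poly p [:c:]) (poly q [:c:])"
      using c cop by (intro coprime_if_no_common_root) auto
    ultimately show "ratfun1_degree (restrict_fst ?f c) = d"
      using c deg by (simp add: ratfun1_degree_Fract)
  qed
qed

lemma degree_snd_eq:
  assumes "p \<noteq> 0" "q \<noteq> 0" and "finite A"
    and cop: "\<And>s t. poly (poly p [:t:]) s = 0 \<Longrightarrow> poly (poly q [:t:]) s = 0 \<Longrightarrow> s \<in> A"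
  shows "degree_snd (to_fract p / to_fract q) = max (degree p) (degree q)"
proof -
  let ?f = "to_fract p / to_fract q"
  let ?n = "fst (quot_of_fract ?f)" and ?d = "snd (quot_of_fract ?f)"
  let ?e = "\<lambda>c. map_poly (\<lambda>r. poly r c)"
  let ?bad = "\<lambda>p. {c. degree (?e c p) \<noteq> degree p \<or> ?e c p = 0}"
  have eq: "?n * q = p * ?d" using assms(2) by (rule quot_of_fract_proportional)
  show ?thesis
    unfolding degree_snd_def
  proof (rule generic_value_eqI)
    show "finite (A \<union> ?bad p \<union> ?bad q \<union> ?bad ?d)"
      using assms(3) finite_degree_drop_snd [OF assms(1)] finite_degree_drop_snd [OF assms(2)]
        finite_degree_drop_snd [of ?d] by simp
    fix c assume c: "c \<notin> A \<union> ?bad p \<union> ?bad q \<union> ?bad ?d"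
    have "?e c ?n * ?e c q = ?e c p * ?e c ?d"
      using arg_cong [OF eq, of "?e c"] by (simp add: map_poly_eval_mult)
    then have "restrict_snd ?f c = Fract (?e c p) (?e c q)"
      using c by (simp add: restrict_snd_def eq_fract)
    moreover have "coprime (?e c p) (?e c q)"
      using c cop by (intro coprime_if_no_common_root) (auto simp: poly_map_poly_eval)
    ultimately show "ratfun1_degree (restrict_snd ?f c) = max (degree p) (degree q)"
      using c by (simp add: ratfun1_degree_Fract)
  qed
qed

section \<open>Algebraic identities behind the linearisation and the Riccati equations\<close>

section \<open>Identities in a field\<close>

text \<open>Cayley-Hamilton for the product of the companion matrices of two successive steps: their
  determinants \<open>q\<close> and \<open>1 / q\<close> multiply to 1, and the coefficient of
  \<open>z2\<close> is the trace.\<close>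

lemma four_step_recurrence:
  fixes q :: "'f::field"
  assumes "q \<noteq> 0"
    and z2: "z2 = - c * (1 + q) * z1 - q * z0"
    and z3: "z3 = - c * (1 + 1 / q) * z2 - 1 / q * z1"
    and z4: "z4 = - c * (1 + q) * z3 - q * z2"
  shows "z4 = (c^2 * (1 + q)^2 / q - q - 1 / q) * z2 - z0"
proof -
  \<comment> \<open>The reciprocal enters as a variable with \<open>q * i = 1\<close>, which turns
    the claim into a polynomial consequence for \<open>algebra\<close>.\<close>
  define i where "i = 1 / q"
  have qi: "q * i = 1" using assms(1) by (simp add: i_def)
  have "z3 = - c * (1 + i) * z2 - i * z1" using z3 by (simp add: i_def)
  then have "z4 = (c^2 * (1 + q)^2 * i - q - i) * z2 - z0"
    using qi z2 z4 by algebra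
  then show ?thesis by (simp add: i_def)
qed

text \<open>Eliminating \<open>q\<close> from the linear step by means of the invariant gives the
  formula for the map, multiplied by \<open>B\<close>.\<close>

lemma linear_step_eq_phi:
  fixes A B :: "'f::field"
  assumes "B \<noteq> 0" and d: "B * x + A * y \<noteq> 0"
    and lin: "B * X + A * x = - q * (A * x + B * y)"
    and inv: "q * ((B * x + A * y) * (A * x + B * y)) = (B^2 - A^2) * (x * y + A * B)"
  shows "X = - (A * x^2 + B * x * y + A * (B^2 - A^2)) / (B * x + A * y)"
proof -
  have "B * (X * (B * x + A * y)) = B * (- (A * x^2 + B * x * y + A * (B^2 - A^2)))"
    using lin inv by algebra
  then have "X * (B * x + A * y) = - (A * x^2 + B * x * y + A * (B^2 - A^2))"
    using assms(1) mult_left_cancel by blast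
  then show ?thesis using d by (simp add: eq_divide_eq)
qed

text \<open>This is p_n p_{n+1} = 1 without division, so it can be iterated before the denominators
  along the orbit are known to be nonzero.\<close>

lemma invariant_step:
  fixes A B :: "'f::field"
  assumes "q * r = 1"
    and lin: "B * X + A * x = - q * (A * x + B * y)"
    and inv: "q * ((B * x + A * y) * (A * x + B * y)) = (B^2 - A^2) * (x * y + A * B)"
  shows "r * ((B * X + A * x) * (A * X + B * x)) = (B^2 - A^2) * (X * x + A * B)"
  using assms by algebra

text \<open>Reversibility: the cleared relation
  \<open>B * x * (X + y) + A * (x^2 + X * y) + A * (B^2 - A^2) = 0\<close> is symmetric in
  \<open>X\<close> and \<open>y\<close>.\<close>

lemma phi_inverse_identity:
  fixes A B :: "'f::field"
  assumes X: "X = - (A * x^2 + B * x * y + A * (B^2 - A^2)) / (B * x + A * y)"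
    and "B * x + A * y \<noteq> 0" and "B * x + A * X \<noteq> 0"
  shows "- (A * x^2 + B * x * X + A * (B^2 - A^2)) / (B * x + A * X) = y"
proof -
  have "X * (B * x + A * y) = - (A * x^2 + B * x * y + A * (B^2 - A^2))"
    using assms(2) by (simp add: X)
  then have "- (A * x^2 + B * x * X + A * (B^2 - A^2)) = y * (B * x + A * X)"
    by algebra
  then show ?thesis using assms(3) by simp
qed

text \<open>After multiplication by powers of \<open>B * x + A * y\<close> and
  \<open>A * x + B * y\<close>, every factor is a polynomial in \<open>x\<close> and
  \<open>y\<close>. Then \<open>core\<close> is the identity that remains.\<close>

lemma v_identity:
  fixes A B :: "'f::field"
  assumes D: "B * x + A * y \<noteq> 0" and E: "A * x + B * y \<noteq> 0" and K: "B^2 - A^2 \<noteq> 0"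
    and X: "X = - (A * x^2 + B * x * y + A * (B^2 - A^2)) / (B * x + A * y)"
    and V: "V = (A^2 + B^2 - x^2 - y^2) / ((A * x + B * y) * (B * x + A * y))"
    and XE: "A * X + B * x \<noteq> 0" and XD: "B * X + A * x \<noteq> 0" and "A * B * V + 1 \<noteq> 0"
  shows "(A^2 + B^2 - X^2 - x^2) / ((A * X + B * x) * (B * X + A * x)) =
     (4 * A * B - (B^2 - A^2)^2 * V) / ((B^2 - A^2)^2 * (A * B * V + 1))"
proof -
  have X': "X * (B * x + A * y) = - (A * x^2 + B * x * y + A * (B^2 - A^2))"
    using D by (simp add: X)
  have V': "V * ((A * x + B * y) * (B * x + A * y)) = A^2 + B^2 - x^2 - y^2"
    using D E by (simp add: V)
  let ?m = "(B * x + A * y)^2 * ((A * x + B * y) * (B * x + A * y))"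
  have XE': "(A * X + B * x) * (B * x + A * y) = (B^2 - A^2) * (x^2 - A^2)"
    using X' by algebra
  have XD': "(B * X + A * x) * (B * x + A * y) = - (B^2 - A^2) * (x * y + A * B)"
    using X' by algebra
  have V1: "(A * B * V + 1) * ((A * x + B * y) * (B * x + A * y)) = (A^2 + B^2) * (x * y + A * B)"
    using V' by algebra
  have n1: "(A^2 + B^2 - X^2 - x^2) * (B * x + A * y)^2 =
      (A^2 + B^2 - x^2) * (B * x + A * y)^2 - (A * x^2 + B * x * y + A * (B^2 - A^2))^2"
    using X' by algebra
  have n2: "(4 * A * B - (B^2 - A^2)^2 * V) * ((A * x + B * y) * (B * x + A * y)) =
      4 * A * B * ((A * x + B * y) * (B * x + A * y)) - (B^2 - A^2)^2 * (A^2 + B^2 - x^2 - y^2)"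
    using V' by algebra
  have core: "((A^2 + B^2 - x^2) * (B * x + A * y)^2 - (A * x^2 + B * x * y + A * (B^2 - A^2))^2) *
        (A^2 + B^2) =
      - (4 * A * B * ((A * x + B * y) * (B * x + A * y)) - (B^2 - A^2)^2 * (A^2 + B^2 - x^2 - y^2)) *
        (x^2 - A^2)"
    by algebra
  \<comment> \<open>Splits off \<open>x * y + A * B\<close>, the factor shared by \<open>V1\<close>
    and \<open>XD'\<close>, so that only \<open>core\<close> is left.\<close>
  have scale: "k^2 * n * (h * p) = m * (k * s * (- k * p))" if "n * h = - m * s" for k n h p m s :: 'f
    using that by algebra
  have "(A^2 + B^2 - X^2 - x^2) * ((B^2 - A^2)^2 * (A * B * V + 1)) * ?m =
      (B^2 - A^2)^2 * ((A^2 + B^2 - X^2 - x^2) * (B * x + A * y)^2) *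
        ((A * B * V + 1) * ((A * x + B * y) * (B * x + A * y)))"
    by (simp add: algebra_simps)
  also have "\<dots> = ((4 * A * B - (B^2 - A^2)^2 * V) * ((A * x + B * y) * (B * x + A * y))) *
        (((A * X + B * x) * (B * x + A * y)) * ((B * X + A * x) * (B * x + A * y)))"
    unfolding n1 n2 XE' XD' V1 using core by (rule scale)
  also have "\<dots> = (4 * A * B - (B^2 - A^2)^2 * V) * ((A * X + B * x) * (B * X + A * x)) * ?m"
    by (simp only: power2_eq_square mult_ac)
  finally have "(A^2 + B^2 - X^2 - x^2) * ((B^2 - A^2)^2 * (A * B * V + 1)) =
      (4 * A * B - (B^2 - A^2)^2 * V) * ((A * X + B * x) * (B * X + A * x))"
    using D E by simp
  then show ?thesis
    using XE XD K assms(8) by (simp add: frac_eq_eq)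
qed

text \<open>Multiplication by \<open>M\<close> clears the denominators of \<open>V\<close> and
  \<open>w\<close>, multiplication by \<open>B * x + A * y\<close> that of \<open>X\<close>. A
  polynomial identity in \<open>x\<close> and \<open>y\<close> remains.\<close>

lemma w_identity:
  fixes A B :: "'f::field"
  assumes D: "B * x + A * y \<noteq> 0" and E: "A * x + B * y \<noteq> 0" and xA: "x - A \<noteq> 0"
    and X: "X = - (A * x^2 + B * x * y + A * (B^2 - A^2)) / (B * x + A * y)"
    and V: "V = (A^2 + B^2 - x^2 - y^2) / ((A * x + B * y) * (B * x + A * y))"
    and w: "w = (y + B) / (x - A)"
    and XA: "X - A \<noteq> 0"
    and den: "- ((A + B) * (A * B * V * w + A^2 * V + w)) + (B - A) \<noteq> 0"
  shows "(x + B) / (X - A) = ((A + B) * (A * B * V * w + B^2 * V + w) + (B - A)) /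
     (- ((A + B) * (A * B * V * w + A^2 * V + w)) + (B - A))"
proof -
  have X': "X * (B * x + A * y) = - (A * x^2 + B * x * y + A * (B^2 - A^2))"
    using D by (simp add: X)
  have V': "V * ((A * x + B * y) * (B * x + A * y)) = A^2 + B^2 - x^2 - y^2"
    using D E by (simp add: V)
  have w': "w * (x - A) = y + B"
    using xA by (simp add: w)
  define M where "M = (A * x + B * y) * (B * x + A * y) * (x - A)"
  have d: "(- ((A + B) * (A * B * V * w + A^2 * V + w)) + (B - A)) * M =
      - ((A + B) * (A * B * (A^2 + B^2 - x^2 - y^2) * (y + B)
          + A^2 * (A^2 + B^2 - x^2 - y^2) * (x - A) + (y + B) * ((A * x + B * y) * (B * x + A * y))))
        + (B - A) * M"
    using V' w' unfolding M_def by algebra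
  have n: "((A + B) * (A * B * V * w + B^2 * V + w) + (B - A)) * M =
      (A + B) * (A * B * (A^2 + B^2 - x^2 - y^2) * (y + B)
          + B^2 * (A^2 + B^2 - x^2 - y^2) * (x - A) + (y + B) * ((A * x + B * y) * (B * x + A * y)))
        + (B - A) * M"
    using V' w' unfolding M_def by algebra
  have XA': "(X - A) * (B * x + A * y) =
      - (A * x^2 + B * x * y + A * (B^2 - A^2)) - A * (B * x + A * y)"
    using X' by algebra
  have "((x + B) * (- ((A + B) * (A * B * V * w + A^2 * V + w)) + (B - A))) * (M * (B * x + A * y)) =
      (x + B) * (B * x + A * y) * ((- ((A + B) * (A * B * V * w + A^2 * V + w)) + (B - A)) * M)"
    by (simp add: mult_ac)
  also have "\<dots> = (((A + B) * (A * B * V * w + B^2 * V + w) + (B - A)) * M) * ((X - A) * (B * x + A * y))"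
    unfolding d n XA' unfolding M_def by algebra
  also have "\<dots> = (((A + B) * (A * B * V * w + B^2 * V + w) + (B - A)) * (X - A)) * (M * (B * x + A * y))"
    by (simp add: mult_ac)
  finally have "(x + B) * (- ((A + B) * (A * B * V * w + A^2 * V + w)) + (B - A)) =
      ((A + B) * (A * B * V * w + B^2 * V + w) + (B - A)) * (X - A)"
    using D E xA by (simp add: M_def)
  then show ?thesis
    using XA den by (simp add: frac_eq_eq)
qed

text \<open>The trace does not see the inversion of the multiplier, so one coefficient serves both
  parities of the orbit.\<close>

lemma trace_inverse:
  fixes p :: "'f::field"
  assumes "p \<noteq> 0"
  shows "c^2 * (1 + 1 / p)^2 / (1 / p) - 1 / p - 1 / (1 / p) = c^2 * (1 + p)^2 / p - p - 1 / p"
proof -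
  have "(1 + 1 / p)^2 / (1 / p) = (1 + p)^2 / p"
    using assms by (simp add: field_simps power2_eq_square)
  then have "c^2 * (1 + 1 / p)^2 / (1 / p) = c^2 * (1 + p)^2 / p"
    by (metis times_divide_eq_right)
  then show ?thesis by simp
qed

lemma trace_fraction:
  fixes p r :: "'f::field"
  assumes "p \<noteq> 0" "r \<noteq> 0"
  shows "c^2 * (1 + p / r)^2 / (p / r) - p / r - 1 / (p / r) = (c^2 * (p + r)^2 - p^2 - r^2) / (p * r)"
proof -
  have "c^2 * (1 + p / r)^2 / (p / r) = c^2 * (p + r)^2 / (p * r)"
  proof -
    have "(1 + p / r)^2 / (p / r) = (p + r)^2 / (p * r)"
      using assms by (simp add: field_simps power2_eq_square)
    then show ?thesis by (metis times_divide_eq_right)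
  qed
  moreover have "p / r = p^2 / (p * r)" "1 / (p / r) = r^2 / (p * r)"
    using assms by (simp_all add: power2_eq_square)
  ultimately show ?thesis by (simp add: diff_divide_distrib)
qed

lemma linear_step_residual:
  fixes A B :: "'f::field"
  assumes "B \<noteq> 0" and "X = - (A / B) * (1 + q) * x - q * y"
  shows "B * X + A * x = - q * (A * x + B * y)"
proof -
  define c where "c = A / B"
  have "A = c * B" using assms(1) by (simp add: c_def)
  moreover have "X = - c * (1 + q) * x - q * y" using assms(2) by (simp add: c_def)
  ultimately show ?thesis by algebra
qed

text \<open>The step denominator is \<open>- p / d\<close>, so one factor \<open>d\<close> cancels.
  This yields the denominator \<open>D * P\<close> of the second iterate.\<close>

lemma second_step_fraction:
  fixes A B :: "'f::field"
  assumes "d \<noteq> 0" and "B * n + A * x * d = - p"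
  shows "- (A * (n / d)^2 + B * (n / d) * x + A * k) / (B * (n / d) + A * x) =
    (A * n^2 + B * x * n * d + A * k * d^2) / (d * p)"
proof -
  have 1: "A * (n / d)^2 + B * (n / d) * x + A * k = (A * n^2 + B * x * n * d + A * k * d^2) / d^2"
    using assms(1) by (simp add: field_simps power2_eq_square)
  have 2: "B * (n / d) + A * x = - p / d"
    using assms(1) by (simp add: field_simps flip: assms(2))
  show ?thesis
    unfolding 1 2 using assms(1) by (simp add: power2_eq_square)
qed

text \<open>
  For fixed \<open>V\<close>, the line of slope \<open>w\<close> through the base point \<open>(A, - B)\<close> meets the conic again at
  \<open>(A + t, w * t - B)\<close>, where \<open>t\<close> is the root of \<open>conic_slope * t + conic_const = 0\<close>.
\<close>

definition conic_slope :: "'f::field \<Rightarrow> 'f \<Rightarrow> 'f \<Rightarrow> 'f \<Rightarrow> 'f" where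
  "conic_slope A B V w = (1 + A * B * V) * (1 + w^2) + V * (A^2 + B^2) * w"

definition conic_const :: "'f::field \<Rightarrow> 'f \<Rightarrow> 'f \<Rightarrow> 'f \<Rightarrow> 'f" where
  "conic_const A B V w = 2 * (1 + A * B * V) * (A - B * w) + V * (A^2 + B^2) * (A * w - B)"

lemma conic_chord:
  fixes A B :: "'f::field"
  assumes "B * x + A * y \<noteq> 0" and "A * x + B * y \<noteq> 0" and xA: "x - A \<noteq> 0"
    and V: "V = (A^2 + B^2 - x^2 - y^2) / ((A * x + B * y) * (B * x + A * y))"
    and w: "w = (y + B) / (x - A)"
    and "conic_slope A B V w \<noteq> 0"
  shows "- conic_const A B V w / conic_slope A B V w = x - A"
proof -
  have V': "V * ((A * x + B * y) * (B * x + A * y)) = A^2 + B^2 - x^2 - y^2"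
    using assms(1,2) by (simp add: V)
  have w': "w * (x - A) = y + B"
    using xA by (simp add: w)
  \<comment> \<open>The base point \<open>(A, - B)\<close> lies on the conic for every
    \<open>V\<close>. It accounts for the factor \<open>x - A\<close>; the linear factor gives the
    second intersection.\<close>
  have "(x - A) * ((x - A) * conic_slope A B V w + conic_const A B V w) = 0"
    unfolding conic_slope_def conic_const_def using V' w' by algebra
  then have "- conic_const A B V w = (x - A) * conic_slope A B V w"
    using xA by (simp add: eq_neg_iff_add_eq_0 neg_eq_iff_add_eq_0 add.commute)
  then show ?thesis using assms(6) by simp
qed

lemma conic_param:
  fixes A B :: "'f::field"
  assumes "conic_slope A B V w \<noteq> 0"
    and t: "t = - conic_const A B V w / conic_slope A B V w"
    and "A * (A + t) + B * (w * t - B) \<noteq> 0" and "B * (A + t) + A * (w * t - B) \<noteq> 0"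
  shows "(A^2 + B^2 - (A + t)^2 - (w * t - B)^2) /
    ((A * (A + t) + B * (w * t - B)) * (B * (A + t) + A * (w * t - B))) = V"
proof -
  have "t * conic_slope A B V w + conic_const A B V w = 0"
    using assms(1) by (simp add: t)
  then have "A^2 + B^2 - (A + t)^2 - (w * t - B)^2 =
      V * ((A * (A + t) + B * (w * t - B)) * (B * (A + t) + A * (w * t - B)))"
    unfolding conic_slope_def conic_const_def by algebra
  then show ?thesis using assms(3,4) by simp
qed

text \<open>Change of parameters to \<open>A = d * (al - be) / 2\<close> and
  \<open>B = d * (al + be) / 2\<close>; numerator and denominator share the factor
  \<open>2 / d\<close>.\<close>

lemma phi_parameters:
  fixes A B d :: "'f::field"
  assumes "d \<noteq> 0" "(2 :: 'f) \<noteq> 0" and al: "al = (A + B) / d" and be: "be = (B - A) / d"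
  shows "(d^2 * al * be * (be - al) - al * x * (x + y) + be * x * (x - y)) /
      (al * (x + y) + be * (x - y)) =
    - (A * x^2 + B * x * y + A * (B^2 - A^2)) / (B * x + A * y)"
proof -
  define e where "e = 1 / d"
  have e: "d * e = 1" "e \<noteq> 0" using assms(1) by (simp_all add: e_def)
  have ab: "al = (A + B) * e" "be = (B - A) * e" by (simp_all add: al be e_def)
  have "d^2 * al * be * (be - al) - al * x * (x + y) + be * x * (x - y) =
      (2 * e) * - (A * x^2 + B * x * y + A * (B^2 - A^2))"
    using e(1) ab by algebra
  moreover have "al * (x + y) + be * (x - y) = (2 * e) * (B * x + A * y)"
    using ab by algebra
  ultimately show ?thesis
    using assms(2) e(2) by (simp only: mult_divide_mult_cancel_left mult_eq_0_iff simp_thms)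
qed

lemma v_parameters:
  fixes A B d :: "'f::field"
  assumes "d \<noteq> 0" "(2 :: 'f) \<noteq> 0" and al: "al = (A + B) / d" and be: "be = (B - A) / d"
  shows "(d^2 * (al^2 + be^2) - 2 * (x^2 + y^2)) / (al^2 * (x + y)^2 - be^2 * (x - y)^2) =
    d^2 / 2 * ((A^2 + B^2 - x^2 - y^2) / ((A * x + B * y) * (B * x + A * y)))"
proof -
  define e where "e = 1 / d"
  have e: "d * e = 1" "e \<noteq> 0" using assms(1) by (simp_all add: e_def)
  have ab: "al = (A + B) * e" "be = (B - A) * e" by (simp_all add: al be e_def)
  have n: "d^2 * (al^2 + be^2) - 2 * (x^2 + y^2) = 2 * (A^2 + B^2 - x^2 - y^2)"
    using e(1) ab by algebra
  have m: "al^2 * (x + y)^2 - be^2 * (x - y)^2 = 2 * (2 * e^2 * ((A * x + B * y) * (B * x + A * y)))"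
    using ab by algebra
  have cancel: "2 * p / (2 * (2 * e^2 * q)) = 1 / (2 * e^2) * (p / q)" for p q
    using assms(2) by (simp only: mult_divide_mult_cancel_left times_divide_times_eq mult_1_left simp_thms)
  have "1 / (2 * e^2) = d^2 / 2" using assms(1) by (simp add: e_def power_divide)
  then show ?thesis
    unfolding n m cancel by (simp only:)
qed

lemma riccati_parameters:
  fixes A B d :: "'f::field"
  assumes "d \<noteq> 0" "(2 :: 'f) \<noteq> 0" and al: "al = (A + B) / d" and be: "be = (B - A) / d"
    and V: "V = v / (d^2 / 2)"
  shows "(al^2 - be^2 - 2 * al^2 * be^2 * v) / (al^2 * be^2 * ((al^2 - be^2) * v + 2)) =
      d^2 / 2 * ((4 * A * B - (B^2 - A^2)^2 * V) / ((B^2 - A^2)^2 * (A * B * V + 1)))"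
    and "(al * (al^2 - be^2) * v * w + al * (al + be)^2 * v + 2 * al * w + 2 * be) /
      (- (al * (al^2 - be^2)) * v * w - al * (al - be)^2 * v - 2 * al * w + 2 * be) =
      ((A + B) * (A * B * V * w + B^2 * V + w) + (B - A)) /
      (- ((A + B) * (A * B * V * w + A^2 * V + w)) + (B - A))"
proof -
  define e where "e = 1 / d"
  have e: "d * e = 1" "e \<noteq> 0" using assms(1) by (simp_all add: e_def)
  have ab: "al = (A + B) * e" "be = (B - A) * e" by (simp_all add: al be e_def)
  have V': "V = 2 * v * e^2" by (simp add: V e_def power_divide)
  have n: "al^2 - be^2 - 2 * al^2 * be^2 * v = e^2 * (4 * A * B - (B^2 - A^2)^2 * V)"
    unfolding ab V' by algebra
  have m: "al^2 * be^2 * ((al^2 - be^2) * v + 2) = e^2 * (2 * e^2) * ((B^2 - A^2)^2 * (A * B * V + 1))"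
    unfolding ab V' by algebra
  have cancel: "e^2 * p / (e^2 * (2 * e^2) * q) = 1 / (2 * e^2) * (p / q)" for p q
    using e(2) by simp
  have "1 / (2 * e^2) = d^2 / 2" using assms(1) by (simp add: e_def power_divide)
  then show "(al^2 - be^2 - 2 * al^2 * be^2 * v) / (al^2 * be^2 * ((al^2 - be^2) * v + 2)) =
      d^2 / 2 * ((4 * A * B - (B^2 - A^2)^2 * V) / ((B^2 - A^2)^2 * (A * B * V + 1)))"
    unfolding n m cancel by (simp only:)
  have "al * (al^2 - be^2) * v * w + al * (al + be)^2 * v + 2 * al * w + 2 * be =
      (2 * e) * ((A + B) * (A * B * V * w + B^2 * V + w) + (B - A))"
    unfolding ab V' by algebra
  moreover have "- (al * (al^2 - be^2)) * v * w - al * (al - be)^2 * v - 2 * al * w + 2 * be =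
      (2 * e) * (- ((A + B) * (A * B * V * w + A^2 * V + w)) + (B - A))"
    unfolding ab V' by algebra
  ultimately show "(al * (al^2 - be^2) * v * w + al * (al + be)^2 * v + 2 * al * w + 2 * be) /
      (- (al * (al^2 - be^2)) * v * w - al * (al - be)^2 * v - 2 * al * w + 2 * be) =
      ((A + B) * (A * B * V * w + B^2 * V + w) + (B - A)) /
      (- ((A + B) * (A * B * V * w + A^2 * V + w)) + (B - A))"
    using assms(2) e(2) by (simp only: mult_divide_mult_cancel_left mult_eq_0_iff simp_thms)
qed

section \<open>Numerators and denominators of the iterates\<close>

section \<open>The orbit as a sequence of polynomials\<close>

text \<open>In the original parameters \<open>b^2 - a^2\<close> is delta^2 alpha beta, and the first
  two conditions say alpha^2 and beta^2 differ. The case \<open>a^2 + b^2 = 0\<close> is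
  included.\<close>

locale orbit =
  fixes a b :: complex
  assumes a0: "a \<noteq> 0" and b0: "b \<noteq> 0" and k0: "b^2 - a^2 \<noteq> 0"
begin

text \<open>\<open>N / D\<close> is the first component of the map, \<open>E\<close> the denominator
  of its inverse, and \<open>P / R\<close> the quantity p_0.\<close>

definition D :: "complex poly poly" where "D = pconst b * px + pconst a * py"
definition E :: "complex poly poly" where "E = pconst a * px + pconst b * py"
definition P :: "complex poly poly" where "P = pconst (b^2 - a^2) * (px * py + pconst (a * b))"
definition R :: "complex poly poly" where "R = D * E"
definition tau :: "complex poly poly" where
  "tau = pconst ((a / b)^2) * (P + R)^2 - P^2 - R^2"
definition N :: "complex poly poly" where
  "N = - (pconst a * px^2 + pconst b * px * py + pconst (a * (b^2 - a^2)))"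

text \<open>
  \<open>num n / den n\<close> is \<open>u\<^sub>n\<close>, started from \<open>x\<close> at \<open>n = 0\<close> with predecessor \<open>y\<close>. The fourth equation of
  \<open>num\<close> is \<open>u\<^sub>n\<^sub>+\<^sub>3 = T u\<^sub>n\<^sub>+\<^sub>1 - u\<^sub>n\<^sub>-\<^sub>1\<close> with \<open>T = tau / (P * R)\<close>. The case \<open>n = 2\<close> is separate, because
  running this recursion from \<open>u\<^sub>0\<close> would leave the common factor \<open>E\<close>.
\<close>

fun num :: "nat \<Rightarrow> complex poly poly" where
  "num 0 = px"
| "num (Suc 0) = N"
| "num (Suc (Suc 0)) =
     pconst a * N^2 + pconst b * px * N * D + pconst (a * (b^2 - a^2)) * D^2"
| "num (Suc (Suc (Suc n))) = tau * num (Suc n) -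
     P * R * (if n = 0 then py * D else if n = 1 then px * (D * P) else P * R * num (n - 1))"

fun den :: "nat \<Rightarrow> complex poly poly" where
  "den 0 = 1"
| "den (Suc 0) = D"
| "den (Suc (Suc 0)) = D * P"
| "den (Suc (Suc (Suc n))) = P * R * den (Suc n)"

definition u :: "nat \<Rightarrow> ratfun2" where "u n = to_fract (num n) / to_fract (den n)"

section \<open>Degrees in each of the two variables\<close>

subsection \<open>Degrees\<close>

lemmas poly_defs = D_def E_def P_def R_def N_def pconst_def px_def py_def

lemma poly_D: "poly D [:c:] = [:a * c, b:]" by (simp add: poly_defs)
lemma poly_E: "poly E [:c:] = [:b * c, a:]" by (simp add: poly_defs)
lemma poly_P: "poly P [:c:] = [:(b^2 - a^2) * (a * b), (b^2 - a^2) * c:]" by (simp add: poly_defs)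
lemma poly_N: "poly N [:c:] = [:- (a * (b^2 - a^2)), - (b * c), - a:]"
  by (simp add: poly_defs power2_eq_square)

lemma poly_R: "poly R [:c:] = [:a * b * c^2, (a^2 + b^2) * c, a * b:]"
  by (simp add: R_def poly_D poly_E power2_eq_square algebra_simps)

lemma square_quadratic:
  "[:r, s, t:]^2 = [:r^2, 2 * r * s, s^2 + 2 * r * t, 2 * s * t, t^2 :: complex:]"
  by (simp add: power2_eq_square algebra_simps)

text \<open>On the line y = c, \<open>P\<close> is at most linear and \<open>R\<close> has leading
  coefficient \<open>a * b\<close>, so \<open>tau\<close> has leading coefficient
  \<open>- (b^2 - a^2) * a^2\<close> for every \<open>c\<close>.\<close>

lemma degree_poly_tau: "degree (poly tau [:c:]) = 4"
proof -
  have "(a / b)^2 * (a * b)^2 - (a * b)^2 = - (b^2 - a^2) * a^2"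
    using b0 by (simp add: field_simps power2_eq_square)
  then have lc: "(a / b)^2 * (a * b)^2 - (a * b)^2 \<noteq> 0"
    using a0 k0 by simp
  obtain m0 m1 where PR: "poly (P + R) [:c:] = [:m0, m1, a * b:]"
    by (simp add: poly_P poly_R)
  obtain p0 p1 where P: "poly P [:c:] = [:p0, p1, 0:]"
    by (simp add: poly_P)
  obtain r0 r1 where R: "poly R [:c:] = [:r0, r1, a * b:]"
    by (simp add: poly_R)
  have "poly tau [:c:] = smult ((a / b)^2) ([:m0, m1, a * b:]^2) - [:p0, p1, 0:]^2 - [:r0, r1, a * b:]^2"
    using PR P R by (simp add: tau_def) (simp add: pconst_def)
  then show ?thesis
    unfolding square_quadratic using lc by simp
qed

text \<open>The factor \<open>P * R\<close> contributes at most 3 and the other factor at most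
  \<open>2 * n + 1\<close>, so \<open>tau * num (Suc n)\<close> dominates the recursion.\<close>

lemma degree_poly_res:
  assumes "\<And>m. m \<le> n \<Longrightarrow> degree (poly (num (Suc m)) [:c:]) = 2 * Suc m"
  shows "degree (poly (P * R *
    (if n = 0 then py * D else if n = 1 then px * (D * P) else P * R * num (n - 1))) [:c:]) < 2 * (n + 3)"
proof -
  have PR: "degree (poly (P * R) [:c:]) \<le> 3"
    by (simp add: poly_P poly_R)
  let ?r = "if n = 0 then py * D else if n = 1 then px * (D * P) else P * R * num (n - 1)"
  have "degree (poly ?r [:c:]) \<le> 2 * n + 1"
  proof -
    consider "n = 0" | "n = 1" | m where "n = Suc (Suc m)"
      by (metis One_nat_def not0_implies_Suc)
    then show ?thesis
    proof cases
      case 1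
      then show ?thesis by (simp add: poly_D py_def)
    next
      case 2
      then show ?thesis by (simp add: poly_D poly_P px_def)
    next
      case 3
      have "degree (poly (P * R * num (Suc m)) [:c:]) \<le> 3 + 2 * Suc m"
        using degree_mult_le [of "poly (P * R) [:c:]" "poly (num (Suc m)) [:c:]"] PR assms [of m] 3
        by (simp only: poly_mult)
      then show ?thesis using 3 by simp
    qed
  qed
  then have "degree (poly (P * R) [:c:] * poly ?r [:c:]) \<le> 3 + (2 * n + 1)"
    using degree_mult_le [of "poly (P * R) [:c:]" "poly ?r [:c:]"] PR by linarith
  then show ?thesis unfolding poly_mult by (rule le_less_trans) simp
qed

lemma degree_poly_num: "degree (poly (num (Suc n)) [:c:]) = 2 * Suc n"
proof (induction n rule: less_induct)
  case (less n)
  consider "n = 0" | "n = 1" | m where "n = Suc (Suc m)"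
    by (metis One_nat_def not0_implies_Suc)
  then show ?case
  proof cases
    case 1
    then show ?thesis using a0 by (simp add: poly_N)
  next
    case 2
    \<comment> \<open>The coefficient of x^4 in \<open>num 2\<close>; the term with
      \<open>D^2\<close> only reaches degree 2.\<close>
    have "a * (a * a) - b * (a * b) = - a * (b^2 - a^2)"
      by (simp add: algebra_simps power2_eq_square)
    then have lc: "a * (a * a) - b * (a * b) \<noteq> 0"
      using a0 k0 by simp
    then show ?thesis
      unfolding 2 by (simp add: poly_N poly_D px_def) (simp add: pconst_def power2_eq_square algebra_simps)
  next
    case 3
    let ?r = "P * R * (if m = 0 then py * D else if m = 1 then px * (D * P) else P * R * num (m - 1))"
    have num: "degree (poly (num (Suc m)) [:c:]) = 2 * Suc m"
      using less.IH [of m] 3 by simp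
    then have "degree (poly (tau * num (Suc m)) [:c:]) = 4 + 2 * Suc m"
      using degree_poly_tau [of c] by (simp add: degree_mult_eq) (subst degree_mult_eq; fastforce)
    moreover have "degree (poly ?r [:c:]) < 2 * (m + 3)"
      using less.IH 3 by (intro degree_poly_res) simp
    ultimately have "degree (poly (tau * num (Suc m)) [:c:] + - poly ?r [:c:]) = 4 + 2 * Suc m"
      by (subst degree_add_eq_left) simp_all
    then show ?thesis using 3 by simp
  qed
qed

text \<open>A double step adds at most 3 here but exactly 4 to the numerator. The strict inequality
  also shows that the iterates are not constant.\<close>

lemma degree_poly_den: "degree (poly (den (Suc n)) [:c:]) < 2 * Suc n"
proof (induction n rule: less_induct)
  case (less n)
  consider "n = 0" | "n = 1" | m where "n = Suc (Suc m)"
    by (metis One_nat_def not0_implies_Suc)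
  then show ?case
  proof cases
    case 1
    then show ?thesis by (simp add: poly_D)
  next
    case 2
    then show ?thesis by (simp add: poly_D poly_P)
  next
    case 3
    have "degree (poly (P * R) [:c:]) \<le> 3"
      by (simp add: poly_P poly_R)
    moreover have "degree (poly (den (Suc m)) [:c:]) < 2 * Suc m"
      using less.IH [of m] 3 by simp
    ultimately have "degree (poly (P * R) [:c:] * poly (den (Suc m)) [:c:]) < 2 * Suc n"
      using degree_mult_le [of "poly (P * R) [:c:]" "poly (den (Suc m)) [:c:]"] 3 by simp
    then show ?thesis using 3 by simp
  qed
qed

text \<open>In the second variable upper bounds suffice, since the maximum in
  \<open>ratmap_degree\<close> is attained in the first variable.\<close>

lemma degree_D: "degree D \<le> 1" and degree_E: "degree E \<le> 1"
  and degree_P: "degree P \<le> 1" and degree_N: "degree N \<le> 1"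
  by (simp_all add: poly_defs power2_eq_square)

lemma degree_mult_bound: "degree p \<le> m \<Longrightarrow> degree q \<le> n \<Longrightarrow> degree (p * q) \<le> m + n"
  for p q :: "complex poly poly"
  using degree_mult_le [of p q] by linarith

lemma degree_R: "degree R \<le> 2"
  unfolding R_def using degree_mult_bound [OF degree_D degree_E] by simp

lemma degree_PR: "degree (P * R) \<le> 3"
  using degree_mult_bound [OF degree_P degree_R] by simp

lemma degree_pconst_mult: "degree p \<le> m \<Longrightarrow> degree (pconst c * p) \<le> m"
  by (simp add: pconst_def)

lemma degree_square_bound: "degree p \<le> m \<Longrightarrow> degree (p^2) \<le> 2 * m"
  for p :: "complex poly poly"
  using degree_power_le [of p 2] by linarith

lemma degree_tau: "degree tau \<le> 4"
proof -
  have "degree ((P + R)^2) \<le> 4" "degree (P^2) \<le> 4" "degree (R^2) \<le> 4"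
    using degree_square_bound [of "P + R" 2] degree_square_bound [of P 2] degree_square_bound [of R 2]
      degree_P degree_R degree_add_le [of P 2 R] by simp_all
  then show ?thesis
    unfolding tau_def by (intro degree_diff_le degree_pconst_mult)
qed

lemma degree_num: "degree (num (Suc n)) \<le> 2 * Suc n"
proof (induction n rule: less_induct)
  case (less n)
  consider "n = 0" | "n = 1" | m where "n = Suc (Suc m)"
    by (metis One_nat_def not0_implies_Suc)
  then show ?case
  proof cases
    case 1
    then show ?thesis using degree_N by simp
  next
    case 2
    have "degree (N * D) \<le> 2" "degree (px * (N * D)) \<le> 2"
      using degree_mult_bound [OF degree_N degree_D]
        degree_mult_bound [of px 0 "N * D" 2] by (simp_all add: px_def)
    then have "degree (pconst b * (px * (N * D))) \<le> 4"
      by (intro degree_pconst_mult) simp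
    moreover have "degree (pconst a * N^2) \<le> 4" "degree (pconst (a * (b^2 - a^2)) * D^2) \<le> 4"
      using degree_square_bound [of N 2] degree_square_bound [of D 2] degree_N degree_D
      by (simp_all add: degree_pconst_mult)
    ultimately show ?thesis
      unfolding 2 by (simp add: degree_add_le mult.assoc)
  next
    case 3
    let ?r = "if m = 0 then py * D else if m = 1 then px * (D * P) else P * R * num (m - 1)"
    have r: "degree ?r \<le> 2 * m + 2"
    proof -
      consider "m = 0" | "m = 1" | l where "m = Suc (Suc l)"
        by (metis One_nat_def not0_implies_Suc)
      then show ?thesis
      proof cases
        case 1
        then show ?thesis using degree_mult_bound [of py 1 D 1] degree_D by (simp add: py_def)
      next
        case 2
        then show ?thesis
          using degree_mult_bound [of px 0 "D * P" 2] degree_mult_bound [OF degree_D degree_P]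
          by (simp add: px_def)
      next
        case l: 3
        then show ?thesis
          using degree_mult_bound [OF degree_PR less.IH [of l]] 3 by simp
      qed
    qed
    have "degree (tau * num (Suc m)) \<le> 2 * Suc n"
      using degree_mult_bound [OF degree_tau less.IH [of m]] 3 by simp
    moreover have "degree (P * R * ?r) \<le> 2 * Suc n"
      using degree_mult_bound [OF degree_PR r] 3 by simp
    ultimately have "degree (tau * num (Suc m) - P * R * ?r) \<le> 2 * Suc n"
      by (rule degree_diff_le)
    then show ?thesis unfolding 3 num.simps .
  qed
qed

lemma degree_den: "degree (den (Suc n)) \<le> 2 * Suc n"
proof (induction n rule: less_induct)
  case (less n)
  consider "n = 0" | "n = 1" | m where "n = Suc (Suc m)"
    by (metis One_nat_def not0_implies_Suc)
  then show ?case
  proof cases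
    case 1
    then show ?thesis using degree_D by simp
  next
    case 2
    then show ?thesis using degree_mult_bound [OF degree_D degree_P] by simp
  next
    case 3
    then show ?thesis using degree_mult_bound [OF degree_PR less.IH [of m]] by simp
  qed
qed

lemma nonzero: "D \<noteq> 0" "E \<noteq> 0" "P \<noteq> 0" "R \<noteq> 0"
  using a0 b0 k0 poly_D [of 0] poly_E [of 0] poly_P [of 0] by (auto simp: R_def)

lemma num_nonzero: "num n \<noteq> 0"
  using degree_poly_num [of "n - 1" 0] by (cases n) (auto simp: px_def)

lemma den_nonzero: "den n \<noteq> 0"
  by (induction n rule: den.induct) (simp_all add: nonzero)

section \<open>Common zeros of numerators and denominators\<close>

subsection \<open>Common zeros\<close>

definition special :: "complex set" where "special = {a, - a, b, - b}"

lemma special_iff: "s \<in> special \<longleftrightarrow> s^2 = a^2 \<or> s^2 = b^2"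
  by (auto simp: special_def power2_eq_iff)

abbreviation ev :: "complex poly poly \<Rightarrow> complex \<Rightarrow> complex \<Rightarrow> complex" where
  "ev p s t \<equiv> poly (poly p [:t:]) s"

lemma ev_simps:
  "ev D s t = b * s + a * t" "ev E s t = a * s + b * t"
  "ev P s t = (b^2 - a^2) * (s * t + a * b)"
  "ev N s t = - (a * s^2 + b * s * t + a * (b^2 - a^2))"
  "ev R s t = ev D s t * ev E s t"
  "ev (pconst c) s t = c" "ev px s t = s" "ev py s t = t"
  by (simp_all add: poly_defs power2_eq_square algebra_simps)

text \<open>The denominators vanish only on the curves \<open>D = 0\<close>, \<open>E = 0\<close>
  and \<open>P = 0\<close>. On each of them a suitable special value of one coordinate forces the
  other to be special.\<close>

lemma special_DI:
  assumes "b * s + a * t = 0" "t^2 = b^2"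
  shows "s \<in> special \<and> t \<in> special"
proof -
  have "b^2 * (s^2 - a^2) = 0" using assms by algebra
  then show ?thesis using b0 assms by (simp add: special_iff)
qed

lemma special_EI:
  assumes "a * s + b * t = 0" "t^2 = a^2"
  shows "s \<in> special \<and> t \<in> special"
proof -
  have "a^2 * (s^2 - b^2) = 0" using assms by algebra
  then show ?thesis using a0 assms by (simp add: special_iff)
qed

lemma special_PI:
  assumes "s * t + a * b = 0" "s^2 = a^2 \<or> s^2 = b^2"
  shows "s \<in> special \<and> t \<in> special"
proof -
  have "a^2 * (t^2 - b^2) = 0 \<or> b^2 * (t^2 - a^2) = 0"
    using assms(2)
  proof
    assume "s^2 = a^2" then show ?thesis using assms(1) by algebra
  next
    assume "s^2 = b^2" then show ?thesis using assms(1) by algebra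
  qed
  then show ?thesis using a0 b0 assms by (auto simp: special_iff)
qed

lemma special_N:
  assumes "ev N s t = 0" and "ev (P * R) s t = 0"
  shows "s \<in> special \<and> t \<in> special"
proof -
  have n: "a * s^2 + b * s * t + a * (b^2 - a^2) = 0"
    using assms(1) by (simp only: ev_simps neg_equal_0_iff_equal)
  from assms(2) consider "b * s + a * t = 0" | "a * s + b * t = 0" | "s * t + a * b = 0"
    using k0 by (auto simp: ev_simps)
  then show ?thesis
  proof cases
    case 1
    have "a * ((b^2 - a^2) * (t^2 - b^2)) = 0" using n 1 by algebra
    then have "t^2 = b^2" using a0 k0 by (metis mult_eq_0_iff eq_iff_diff_eq_0)
    with 1 show ?thesis by (rule special_DI)
  next
    case 2
    \<comment> \<open>\<open>N\<close> is \<open>- (s * (a * s + b * t)) - a * (b^2 - a^2)\<close>,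
      a nonzero constant on the curve \<open>E = 0\<close>.\<close>
    have "a * (b^2 - a^2) = 0" using n 2 by algebra
    then show ?thesis using a0 k0 by simp
  next
    case 3
    have "a * (s^2 - a^2) = 0" using n 3 by algebra
    then show ?thesis using a0 3 by (intro special_PI) simp_all
  qed
qed

lemma special_num2:
  assumes "ev (num 2) s t = 0" and "ev (P * R) s t = 0"
  shows "s \<in> special \<and> t \<in> special"
proof -
  define n d where "n = - (a * s^2 + b * s * t + a * (b^2 - a^2))" and "d = b * s + a * t"
  have n2: "a * n^2 + b * s * n * d + a * (b^2 - a^2) * d^2 = 0"
    using assms(1) by (simp add: numeral_2_eq_2 ev_simps n_def d_def)
  from assms(2) consider "d = 0" | "a * s + b * t = 0" | "s * t + a * b = 0"
    using k0 by (auto simp: ev_simps d_def)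
  then show ?thesis
  proof cases
    case 1
    then have "ev N s t = 0" using n2 a0 by (simp add: ev_simps n_def)
    then show ?thesis using assms(2) by (rule special_N)
  next
    case 2
    have n: "n = - (a * (b^2 - a^2))" using 2 unfolding n_def by algebra
    have "a * (b^2 - a^2) * (a^2 * (b^2 - a^2) - b * s * d + d^2) = 0"
      using n2 n by algebra
    then have "a^2 * (b^2 - a^2) - b * s * d + d^2 = 0" using a0 k0 by simp
    then have "(b^2 - a^2) * (t^2 - a^2) = 0" using 2 unfolding d_def by algebra
    then have "t^2 = a^2" using k0 by simp
    with 2 show ?thesis by (rule special_EI)
  next
    case 3
    \<comment> \<open>The identity \<open>b * N + a * x * D = - P\<close>, evaluated at a zero of
      \<open>P\<close>.\<close>
    have n: "b * n = - a * s * d" using 3 unfolding n_def d_def by algebra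
    have "a * (b^2 - a^2) * d^2 * (b^2 - s^2) = 0"
      using n2 n by algebra
    then consider "d = 0" | "s^2 = b^2" using a0 k0 by auto
    then show ?thesis
    proof cases
      case 1
      then have "ev N s t = 0" using n2 a0 by (simp add: ev_simps n_def)
      then show ?thesis using assms(2) by (rule special_N)
    next
      case 2
      with 3 show ?thesis by (intro special_PI) simp_all
    qed
  qed
qed

text \<open>On \<open>P * R = 0\<close> the recursion reduces to multiplication by
  \<open>tau\<close>, so a zero comes either from an earlier numerator or from
  \<open>tau\<close>.\<close>

lemma special_num:
  assumes "ev (num (Suc n)) s t = 0" and "ev (P * R) s t = 0"
  shows "s \<in> special \<and> t \<in> special"
  using assms
proof (induction n rule: less_induct)
  case (less n)
  consider "n = 0" | "n = 1" | m where "n = Suc (Suc m)"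
    by (metis One_nat_def not0_implies_Suc)
  then show ?case
  proof cases
    case 1
    then show ?thesis using less.prems special_N by simp
  next
    case 2
    then show ?thesis using less.prems special_num2 by (simp add: numeral_2_eq_2)
  next
    case 3
    have PR: "ev P s t * ev R s t = 0" using less.prems(2) by simp
    then have "ev (num (Suc n)) s t = ev tau s t * ev (num (Suc m)) s t"
      using 3 by auto
    then consider "ev tau s t = 0" | "ev (num (Suc m)) s t = 0"
      using less.prems(1) by auto
    then show ?thesis
    proof cases
      case 1
      have "(a / b)^2 * (ev P s t + ev R s t)^2 - (ev P s t)^2 - (ev R s t)^2 = 0"
        using 1 by (simp add: tau_def ev_simps(6))
      then have "b^2 * ((a / b)^2 * (ev P s t + ev R s t)^2 - (ev P s t)^2 - (ev R s t)^2) = 0"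
        by simp
      moreover have "b^2 * (a / b)^2 = a^2" using b0 by (simp add: power_divide)
      \<comment> \<open>As \<open>P * R\<close> vanishes, \<open>P^2 + R^2 = (P + R)^2\<close>. A
        zero of \<open>tau\<close> is thus a zero of both \<open>P\<close> and
        \<open>R\<close>.\<close>
      ultimately have "(b^2 - a^2) * (ev P s t + ev R s t)^2 = 0"
        using PR by algebra
      then have "ev P s t + ev R s t = 0" using k0 by simp
      then have "ev P s t = 0" "ev R s t = 0" using PR by auto
      then have st: "s * t + a * b = 0" and "(b * s + a * t) * (a * s + b * t) = 0"
        using k0 by (simp_all add: ev_simps)
      then have "b * s + a * t = 0 \<or> a * s + b * t = 0" by simp
      then have "b * (s^2 - a^2) = 0 \<or> a * (s^2 - b^2) = 0"
        using st by (elim disjE) algebra+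
      then show ?thesis
        using a0 b0 st by (intro special_PI) auto
    next
      case 2
      then show ?thesis using less.IH [of m] less.prems(2) 3 by simp
    qed
  qed
qed

lemma ev_den_zero: "ev (den n) s t = 0 \<Longrightarrow> ev (P * R) s t = 0"
  by (induction n rule: den.induct) (auto simp: R_def)

lemma common_zero:
  assumes "ev (num n) s t = 0" and "ev (den n) s t = 0"
  shows "s \<in> special \<and> t \<in> special"
  using assms special_num ev_den_zero by (cases n) auto

lemma finite_special: "finite special"
  by (simp add: special_def)

lemma degree_fst_u: "degree_fst (u (Suc n)) = 2 * Suc n"
  unfolding u_def
proof (rule degree_fst_eq [OF den_nonzero finite_special])
  show "max (degree (poly (num (Suc n)) [:t:])) (degree (poly (den (Suc n)) [:t:])) = 2 * Suc n" for t
    using degree_poly_den [of n t] by (simp only: degree_poly_num)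
qed (use common_zero in blast)

lemma degree_snd_u: "degree_snd (u (Suc n)) \<le> 2 * Suc n"
proof -
  have "degree_snd (u (Suc n)) = max (degree (num (Suc n))) (degree (den (Suc n)))"
    unfolding u_def
    by (rule degree_snd_eq [OF num_nonzero den_nonzero finite_special]) (use common_zero in blast)
  then show ?thesis using degree_num [of n] degree_den [of n] by simp
qed

lemma degree_u_0: "degree_fst (u 0) = 1" "degree_snd (u 0) = 0"
proof -
  show "degree_fst (u 0) = 1"
    unfolding u_def
    by (rule degree_fst_eq [OF den_nonzero finite_special])
       (use common_zero [of 0] in blast, simp add: px_def)
  show "degree_snd (u 0) = 0"
    unfolding u_def
    by (subst degree_snd_eq [OF num_nonzero den_nonzero finite_special])
       (use common_zero [of 0] in blast, simp add: px_def)
qed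

end

section \<open>Identification of the polynomial fractions with the iterates\<close>

section \<open>The linearised orbit\<close>

context orbit
begin

abbreviation A :: ratfun2 where "A \<equiv> rconst a"
abbreviation B :: ratfun2 where "B \<equiv> rconst b"
abbreviation x :: ratfun2 where "x \<equiv> coord1"
abbreviation y :: ratfun2 where "y \<equiv> coord2"

definition phi :: ratmap where
  "phi = (- (A * x^2 + B * x * y + A * (B^2 - A^2)) / (B * x + A * y), x)"

definition p :: ratfun2 where "p = to_fract P / to_fract R"

definition multiplier :: "nat \<Rightarrow> ratfun2" where
  "multiplier n = (if even n then p else 1 / p)"

text \<open>The orbit generated by the linear recurrence. The index is shifted by one against
  \<open>u\<close>, to make room for the predecessor \<open>y\<close> of the initial value.\<close>

fun z :: "nat \<Rightarrow> ratfun2" where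
  "z 0 = y"
| "z (Suc 0) = x"
| "z (Suc (Suc n)) = - (A / B) * (1 + multiplier n) * z (Suc n) - multiplier n * z n"

lemma p_nonzero: "p \<noteq> 0"
  using nonzero by (simp add: p_def)

lemma multiplier_nonzero: "multiplier n \<noteq> 0"
  using p_nonzero by (simp add: multiplier_def)

lemma multiplier_Suc: "multiplier (Suc n) = 1 / multiplier n"
  using p_nonzero by (simp add: multiplier_def)

definition T :: ratfun2 where "T = (A / B)^2 * (1 + p)^2 / p - p - 1 / p"

lemma T_eq_multiplier: "T = (A / B)^2 * (1 + multiplier n)^2 / multiplier n - multiplier n - 1 / multiplier n"
proof (cases "even n")
  case False
  then show ?thesis using trace_inverse [OF p_nonzero] by (simp only: T_def multiplier_def if_False)
qed (simp add: T_def multiplier_def)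

lemma z_four_step: "z (Suc (Suc (Suc (Suc n)))) = T * z (Suc (Suc n)) - z n"
  unfolding T_eq_multiplier [of n]
proof (rule four_step_recurrence)
  show "z (Suc (Suc (Suc n))) =
      - (A / B) * (1 + 1 / multiplier n) * z (Suc (Suc n)) - 1 / multiplier n * z (Suc n)"
    by (simp only: z.simps multiplier_Suc)
  have "multiplier (Suc (Suc n)) = multiplier n" by (simp add: multiplier_def)
  then show "z (Suc (Suc (Suc (Suc n)))) =
      - (A / B) * (1 + multiplier n) * z (Suc (Suc (Suc n))) - multiplier n * z (Suc (Suc n))"
    by (simp only: z.simps(3) [of "Suc (Suc n)"])
qed (simp_all only: multiplier_nonzero not_False_eq_True z.simps)

lemma T_eq_tau: "T = to_fract tau / (to_fract P * to_fract R)"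
proof -
  have "to_fract P \<noteq> 0" "to_fract R \<noteq> 0" using nonzero by simp_all
  from trace_fraction [OF this] show ?thesis
    by (simp only: T_def p_def tau_def to_fract_simps rconst_simps rconst_divide)
qed

lemma B_nonzero: "B \<noteq> 0" and K_nonzero: "B^2 - A^2 \<noteq> 0"
  using b0 k0 rconst_eq_0_iff [of "b^2 - a^2"] by (simp_all add: rconst_simps del: rconst_eq_0_iff) simp

lemma to_fract_D: "to_fract D = B * x + A * y"
  and to_fract_E: "to_fract E = A * x + B * y"
  and to_fract_P: "to_fract P = (B^2 - A^2) * (x * y + A * B)"
  and to_fract_N: "to_fract N = - (A * x^2 + B * x * y + A * (B^2 - A^2))"
  by (simp_all add: D_def E_def P_def N_def to_fract_simps rconst_simps)

lemma D_nonzero: "B * x + A * y \<noteq> 0" and E_nonzero: "A * x + B * y \<noteq> 0"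
  using nonzero by (simp_all only: to_fract_eq_0_iff not_False_eq_True flip: to_fract_D to_fract_E)

lemma p_eq: "p = (B^2 - A^2) * (x * y + A * B) / ((B * x + A * y) * (A * x + B * y))"
  by (simp add: p_def R_def to_fract_D to_fract_E to_fract_P)

lemma residual: "B * z (Suc (Suc n)) + A * z (Suc n) = - multiplier n * (A * z (Suc n) + B * z n)"
  using B_nonzero by (rule linear_step_residual) simp

lemma multiplier_invariant:
  "multiplier n * ((B * z (Suc n) + A * z n) * (A * z (Suc n) + B * z n)) =
     (B^2 - A^2) * (z (Suc n) * z n + A * B)"
proof (induction n)
  case 0
  have "(B * x + A * y) * (A * x + B * y) \<noteq> 0" using D_nonzero E_nonzero by simp
  then show ?case by (simp add: multiplier_def p_eq)
next
  case (Suc n)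
  have "multiplier n * multiplier (Suc n) = 1"
    using multiplier_nonzero by (simp add: multiplier_Suc)
  from invariant_step [OF this residual Suc] show ?case .
qed

lemma phi_step:
  assumes "B * z (Suc n) + A * z n \<noteq> 0"
  shows "z (Suc (Suc n)) = - (A * z (Suc n)^2 + B * z (Suc n) * z n + A * (B^2 - A^2)) / (B * z (Suc n) + A * z n)"
  using B_nonzero assms residual multiplier_invariant by (rule linear_step_eq_phi)

lemma z_2: "z (Suc (Suc 0)) = u 1"
  using phi_step [of 0] D_nonzero by (simp add: u_def to_fract_D to_fract_N)

lemma z_3: "z (Suc (Suc (Suc 0))) = u 2"
proof -
  let ?n = "to_fract N" and ?d = "to_fract D"
  have z2: "z (Suc (Suc 0)) = ?n / ?d"
    unfolding z_2 by (simp add: u_def)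
  have d: "?d \<noteq> 0" using nonzero by simp
  \<comment> \<open>Shows that the denominator of the second step is \<open>- P / D\<close>, hence
    nonzero.\<close>
  have P: "B * ?n + A * x * ?d = - to_fract P"
    unfolding to_fract_D to_fract_N to_fract_P by algebra
  have "B * (?n / ?d) + A * x = - to_fract P / ?d"
    using d by (simp add: add_divide_distrib flip: P)
  then have "B * z (Suc (Suc 0)) + A * z (Suc 0) \<noteq> 0"
    unfolding z2 using d nonzero by simp
  from phi_step [OF this]
  have "z (Suc (Suc (Suc 0))) = (A * ?n^2 + B * x * ?n * ?d + A * (B^2 - A^2) * ?d^2) / (?d * to_fract P)"
    unfolding z2 z.simps(2) second_step_fraction [OF d P] .
  also have "\<dots> = u 2"
    by (simp only: u_def numeral_2_eq_2 num.simps den.simps to_fract_simps rconst_simps)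
  finally show ?thesis .
qed

lemma z_eq_u: "z (Suc n) = u n"
proof (induction n rule: less_induct)
  case (less n)
  consider "n = 0" | "n = 1" | "n = 2" | m where "n = Suc (Suc (Suc m))"
    by (metis One_nat_def Suc_1 not0_implies_Suc)
  then show ?case
  proof cases
    case 1
    then show ?thesis by (simp add: u_def to_fract_px)
  next
    case 2
    then show ?thesis using z_2 by simp
  next
    case 3
    then show ?thesis using z_3 by (simp add: numeral_2_eq_2)
  next
    case 4
    let ?r = "if m = 0 then py * D else if m = 1 then px * (D * P) else P * R * num (m - 1)"
    have nz: "to_fract P \<noteq> 0" "to_fract R \<noteq> 0" "to_fract D \<noteq> 0" "to_fract (den k) \<noteq> 0" for k
      using nonzero den_nonzero by simp_all
    \<comment> \<open>\<open>?r\<close> is the term \<open>z m\<close> of the four-step recurrence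
      over the denominator \<open>den (Suc m)\<close>. The cases \<open>m = 0\<close> and
      \<open>m = 1\<close> are the initial values \<open>y\<close> and \<open>x\<close>.\<close>
    have "to_fract ?r / to_fract (den (Suc m)) = z m"
    proof -
      consider "m = 0" | "m = 1" | l where "m = Suc (Suc l)"
        by (metis One_nat_def not0_implies_Suc)
      then show ?thesis
      proof cases
        case 1
        then show ?thesis using nz by (simp add: to_fract_py)
      next
        case 2
        then show ?thesis using nz by (simp add: to_fract_px)
      next
        case l: 3
        have "z m = u (Suc l)" using less.IH [of "Suc l"] 4 l by simp
        then show ?thesis using nz l by (simp add: u_def)
      qed
    qed
    moreover have "z (Suc (Suc m)) = u (Suc m)" using less.IH [of "Suc m"] 4 by simp
    ultimately have "z (Suc n) = T * u (Suc m) - to_fract ?r / to_fract (den (Suc m))"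
      unfolding 4 z_four_step by simp
    also have "\<dots> = (to_fract tau * to_fract (num (Suc m)) - to_fract P * to_fract R * to_fract ?r) /
        (to_fract P * to_fract R * to_fract (den (Suc m)))"
      using nz by (simp add: T_eq_tau u_def diff_divide_distrib)
    also have "\<dots> = u n"
      unfolding 4 u_def num.simps den.simps by (simp only: to_fract_mult to_fract_diff)
    finally show ?thesis .
  qed
qed

text \<open>For positive \<open>n\<close> the numerator has larger degree than the denominator on
  the line y = 0.\<close>

lemma u_not_constant: "u n \<noteq> rconst c"
proof
  assume "u n = rconst c"
  then have "to_fract (num n) = to_fract (pconst c * den n)"
    using den_nonzero [of n] by (simp add: u_def to_fract_pconst divide_eq_eq)
  then have eq: "num n = pconst c * den n" by (simp only: to_fract_eq_iff)
  show False
  proof (cases n)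
    case 0
    then show ?thesis using eq by (simp add: px_def pconst_def)
  next
    case (Suc m)
    have "degree (poly (num n) [:0:]) \<le> degree (poly (den n) [:0:])"
      unfolding eq by (simp add: pconst_def)
    then show ?thesis
      using degree_poly_num [of m 0] degree_poly_den [of m 0] Suc by simp
  qed
qed

lemma z_not_constant: "z n \<noteq> rconst c"
proof (cases n)
  case 0
  then show ?thesis by (simp add: coord2_def rconst_def eq_fract)
next
  case (Suc m)
  then show ?thesis by (simp only: z_eq_u u_not_constant not_False_eq_True)
qed

text \<open>If the denominator vanished, the invariant would give
  \<open>z (Suc n) * z n = - A * B\<close>. Together these make \<open>z n\<close> one of the
  constants \<open>B\<close> and \<open>- B\<close>.\<close>

lemma phi_step_defined: "B * z (Suc n) + A * z n \<noteq> 0"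
proof
  assume d: "B * z (Suc n) + A * z n = 0"
  then have "(B^2 - A^2) * (z (Suc n) * z n + A * B) = 0"
    using multiplier_invariant [of n] by simp
  then have "z (Suc n) * z n + A * B = 0" using K_nonzero by simp
  then have "A * ((z n)^2 - B^2) = 0" using d by algebra
  then have "(z n)^2 = B^2" using a0 by simp
  then have "z n = rconst b \<or> z n = rconst (- b)"
    by (simp add: power2_eq_iff rconst_simps)
  then show False using z_not_constant by blast
qed

lemma ratmap_iter_phi: "ratmap_iter phi n = (z (Suc n), z n)"
proof (induction n)
  case 0
  show ?case by (simp add: ratmap_iter_def ratmap_id_def)
next
  case (Suc n)
  have "ratmap_iter phi (Suc n) = ratmap_comp phi (z (Suc n), z n)"
    using Suc by (simp add: ratmap_iter_def)
  moreover have "rsubst (fst phi) (z (Suc n), z n) = z (Suc (Suc n))"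
    unfolding phi_step [OF phi_step_defined] phi_def fst_conv
    by (rule rsubst_eqI) (intro subst_intros phi_step_defined)
  moreover have "rsubst (snd phi) (z (Suc n), z n) = z (Suc n)"
    by (simp add: phi_def rsubst_coord1)
  ultimately show ?case by (simp add: ratmap_comp_def)
qed

text \<open>The components of the iterate are \<open>u n\<close> and \<open>u (n - 1)\<close>. The
  value \<open>2 * n\<close> is the degree of \<open>u n\<close> in the first variable and bounds
  the other three degrees.\<close>

lemma ratmap_degree_iter_phi:
  assumes "n \<ge> 1"
  shows "ratmap_degree (ratmap_iter phi n) = 2 * n"
proof -
  obtain m where n: "n = Suc m" using assms by (cases n) auto
  have "degree_fst (u m) \<le> 2 * n \<and> degree_snd (u m) \<le> 2 * n"
    using degree_u_0 degree_fst_u degree_snd_u by (cases m) (auto simp: n intro: le_SucI)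
  moreover have "degree_fst (u n) = 2 * n" "degree_snd (u n) \<le> 2 * n"
    unfolding n by (rule degree_fst_u degree_snd_u)+
  ultimately show ?thesis
    unfolding ratmap_iter_phi ratmap_degree_def fst_conv snd_conv
    unfolding n z_eq_u by simp
qed

end

section \<open>Birationality of both maps and conjugation to the Riccati system\<close>

section \<open>The Riccati coordinates\<close>

context orbit
begin

lemma birational_phi: "birational phi"
  unfolding birational_def
proof (intro exI conjI)
  \<comment> \<open>By reversibility, the inverse is the map conjugated by the exchange of the
    coordinates.\<close>
  define G where "G = (y, - (A * y^2 + B * y * x + A * (B^2 - A^2)) / (B * y + A * x))"
  let ?X = "- (A * x^2 + B * x * y + A * (B^2 - A^2)) / (B * x + A * y)"
  let ?Y = "- (A * y^2 + B * y * x + A * (B^2 - A^2)) / (B * y + A * x)"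
  have E': "B * y + A * x \<noteq> 0" using E_nonzero by (simp add: add.commute)
  \<comment> \<open>The value of both denominators, \<open>XE\<close> at (0, 1) and
    \<open>YD\<close> at the exchanged point (1, 0). It equals
    \<open>- a * (b^2 - a^2)\<close>.\<close>
  have val: "b * 0 + a * (- (a * 0^2 + b * 0 * 1 + a * (b^2 - a^2)) / (b * 0 + a * 1)) \<noteq> 0"
    using a0 k0 by simp
  have XE: "B * x + A * ?X \<noteq> 0"
    by (rule nonzero_if_nonzero_at [where s = 0 and t = 1, OF _ val], intro at_point_intros)
       (use a0 in simp)
  have YD: "B * y + A * ?Y \<noteq> 0"
    by (rule nonzero_if_nonzero_at [where s = 1 and t = 0, OF _ val], intro at_point_intros)
       (use a0 in simp)
  note 1 = phi_inverse_identity [OF refl D_nonzero XE]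
  note 2 = phi_inverse_identity [OF refl E' YD]
  have "rsubst ?Y (?X, x) = - (A * x^2 + B * x * ?X + A * (B^2 - A^2)) / (B * x + A * ?X)"
    by (rule rsubst_eqI) (intro subst_intros XE)
  then show "ratmap_comp G phi = ratmap_id"
    unfolding 1 by (simp add: ratmap_comp_def G_def phi_def ratmap_id_def rsubst_coord2)
  have "rsubst ?X (y, ?Y) = - (A * y^2 + B * y * ?Y + A * (B^2 - A^2)) / (B * y + A * ?Y)"
    by (rule rsubst_eqI) (intro subst_intros YD)
  then show "ratmap_comp phi G = ratmap_id"
    unfolding 2 by (simp add: ratmap_comp_def G_def phi_def ratmap_id_def rsubst_coord1)
qed

definition V :: ratfun2 where
  "V = (A^2 + B^2 - x^2 - y^2) / ((A * x + B * y) * (B * x + A * y))"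

definition W :: ratfun2 where "W = (y + B) / (x - A)"

definition vw :: "complex \<Rightarrow> ratmap" where "vw c = (rconst c * V, W)"

text \<open>The first coordinate is v, and \<open>x / rconst c\<close> recovers \<open>V\<close>
  from it. For c = delta^2 / 2 this is \<open>riccati_map\<close>.\<close>

definition riccati :: "complex \<Rightarrow> ratmap" where
  "riccati c = (rconst c * ((4 * A * B - (B^2 - A^2)^2 * (x / rconst c)) /
        ((B^2 - A^2)^2 * (A * B * (x / rconst c) + 1))),
     ((A + B) * (A * B * (x / rconst c) * y + B^2 * (x / rconst c) + y) + (B - A)) /
     (- ((A + B) * (A * B * (x / rconst c) * y + A^2 * (x / rconst c) + y)) + (B - A)))"

context
  assumes h0: "a^2 + b^2 \<noteq> 0"
begin

text \<open>At x = -a, y = -b both \<open>V\<close> and \<open>W\<close> vanish, so a polynomial in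
  them takes its constant term as value there. The condition \<open>a^2 + b^2 \<noteq> 0\<close>
  keeps the denominator of \<open>V\<close> nonzero.\<close>

lemma at_V: "at_point.maps_to (- b) (- a) V 0"
proof -
  have "at_point.maps_to (- b) (- a) V ((a^2 + b^2 - (- a)^2 - (- b)^2) /
      ((a * - a + b * - b) * (b * - a + a * - b)))"
    unfolding V_def
  proof (intro at_point_intros)
    have "a * - a + b * - b = - (a^2 + b^2)" by (simp add: power2_eq_square)
    then have "a * - a + b * - b \<noteq> 0"
      using h0 by (simp only: neg_equal_0_iff_equal not_False_eq_True)
    moreover have "b * - a + a * - b \<noteq> 0" using a0 b0 by simp
    ultimately show "(a * - a + b * - b) * (b * - a + a * - b) \<noteq> 0"
      by (simp only: mult_eq_0_iff simp_thms)
  qed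
  then show ?thesis by simp
qed

lemma at_W: "at_point.maps_to (- b) (- a) W 0"
proof -
  have "at_point.maps_to (- b) (- a) W ((- b + b) / (- a - a))"
    unfolding W_def using a0 by (intro at_point_intros) simp
  then show ?thesis by simp
qed

lemma xA_nonzero: "x - A \<noteq> 0"
  using coord1_neq_rconst by simp

lemma vw_comp_phi:
  assumes "c \<noteq> 0"
  shows "ratmap_comp (vw c) phi = ratmap_comp (riccati c) (vw c)"
proof -
  define X where "X = - (A * x^2 + B * x * y + A * (B^2 - A^2)) / (B * x + A * y)"
  have phi: "phi = (X, x)" by (simp add: phi_def X_def)
  have c: "rconst c \<noteq> 0" using assms by simp
  have cV: "rconst c * V / rconst c = V" using c by simp
  have at_X: "at_point.maps_to 1 0 X (- (b^2 - a^2))"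
  proof -
    have "at_point.maps_to 1 0 X (- (a * 0^2 + b * 0 * 1 + a * (b^2 - a^2)) / (b * 0 + a * 1))"
      unfolding X_def using a0 by (intro at_point_intros) simp
    then show ?thesis using a0 by simp
  qed
  have XE: "A * X + B * x \<noteq> 0"
  proof (rule nonzero_if_nonzero_at)
    show "at_point.maps_to 1 0 (A * X + B * x) (a * - (b^2 - a^2) + b * 0)"
      by (intro at_point_intros at_X)
  qed (use a0 k0 in simp)
  have XD: "B * X + A * x \<noteq> 0"
  proof (rule nonzero_if_nonzero_at)
    show "at_point.maps_to 1 0 (B * X + A * x) (b * - (b^2 - a^2) + a * 0)"
      by (intro at_point_intros at_X)
  qed (use b0 k0 in simp)
  \<comment> \<open>At (0, 1) the value would be \<open>- (b^2 - a^2) - a\<close>, which can be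
    zero; at (a, 0) it is \<open>- (b + a)\<close>.\<close>
  have XA: "X - A \<noteq> 0"
  proof (rule nonzero_if_nonzero_at)
    show "at_point.maps_to 0 a (X - A)
        (- (a * a^2 + b * a * 0 + a * (b^2 - a^2)) / (b * a + a * 0) - a)"
      unfolding X_def using a0 b0 by (intro at_point_intros) simp
    have "- (a * a^2 + b * a * 0 + a * (b^2 - a^2)) / (b * a + a * 0) - a = - (b + a)"
      using a0 b0 by (simp add: field_simps power2_eq_square)
    moreover have "b + a \<noteq> 0"
      using k0 by (auto simp: power2_eq_iff eq_neg_iff_add_eq_0)
    ultimately show "- (a * a^2 + b * a * 0 + a * (b^2 - a^2)) / (b * a + a * 0) - a \<noteq> 0"
      by (simp only: neg_equal_0_iff_equal not_False_eq_True)
  qed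
  have V1: "A * B * V + 1 \<noteq> 0"
  proof (rule nonzero_if_nonzero_at)
    show "at_point.maps_to (- b) (- a) (A * B * V + 1) (a * b * 0 + 1)"
      by (intro at_point_intros at_V)
  qed simp
  have den: "- ((A + B) * (A * B * V * W + A^2 * V + W)) + (B - A) \<noteq> 0"
  proof (rule nonzero_if_nonzero_at)
    show "at_point.maps_to (- b) (- a) (- ((A + B) * (A * B * V * W + A^2 * V + W)) + (B - A))
        (- ((a + b) * (a * b * 0 * 0 + a^2 * 0 + 0)) + (b - a))"
      by (intro at_point_intros at_V at_W)
    show "- ((a + b) * (a * b * 0 * 0 + a^2 * 0 + 0)) + (b - a) \<noteq> 0"
      using k0 by auto
  qed
  have 1: "rsubst (rconst c * V) (X, x) =
      rconst c * ((A^2 + B^2 - X^2 - x^2) / ((A * X + B * x) * (B * X + A * x)))"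
    unfolding V_def by (rule rsubst_eqI, intro subst_intros) (use XE XD in simp)
  have 2: "rsubst W (X, x) = (x + B) / (X - A)"
    unfolding W_def by (rule rsubst_eqI, intro subst_intros) (use XA in simp)
  have 3: "rsubst (fst (riccati c)) (rconst c * V, W) =
      rconst c * ((4 * A * B - (B^2 - A^2)^2 * (rconst c * V / rconst c)) /
        ((B^2 - A^2)^2 * (A * B * (rconst c * V / rconst c) + 1)))"
    unfolding riccati_def fst_conv
    by (rule rsubst_eqI, intro subst_intros subst_numeral c)
       (unfold cV, use V1 K_nonzero in simp)
  have 4: "rsubst (snd (riccati c)) (rconst c * V, W) =
     ((A + B) * (A * B * (rconst c * V / rconst c) * W + B^2 * (rconst c * V / rconst c) + W) + (B - A)) /
     (- ((A + B) * (A * B * (rconst c * V / rconst c) * W + A^2 * (rconst c * V / rconst c) + W)) + (B - A))"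
    unfolding riccati_def snd_conv
    by (rule rsubst_eqI, intro subst_intros c)
       (unfold cV, rule den)
  have v: "(A^2 + B^2 - X^2 - x^2) / ((A * X + B * x) * (B * X + A * x)) =
     (4 * A * B - (B^2 - A^2)^2 * V) / ((B^2 - A^2)^2 * (A * B * V + 1))"
    using D_nonzero E_nonzero K_nonzero X_def V_def XE XD V1 by (rule v_identity)
  have w: "(x + B) / (X - A) = ((A + B) * (A * B * V * W + B^2 * V + W) + (B - A)) /
     (- ((A + B) * (A * B * V * W + A^2 * V + W)) + (B - A))"
    using D_nonzero E_nonzero xA_nonzero X_def V_def W_def XA den by (rule w_identity)
  show ?thesis
    unfolding ratmap_comp_def phi vw_def fst_conv snd_conv 1 2 3 4 cV v w ..
qed

lemma birational_vw:
  assumes "c \<noteq> 0"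
  shows "birational (vw c)"
  unfolding birational_def
proof (intro exI conjI)
  \<comment> \<open>The displacement along the chord of slope w from the base point to its second
    intersection with the conic of parameter v; \<open>H\<close> sends (v, w) to that
    intersection.\<close>
  define t where "t = - conic_const A B (x / rconst c) y / conic_slope A B (x / rconst c) y"
  define H where "H = (A + t, y * t - B)"
  have c: "rconst c \<noteq> 0" using assms by simp
  have cV: "rconst c * V / rconst c = V" using c by simp
  have slope: "conic_slope A B V W \<noteq> 0"
  proof (rule nonzero_if_nonzero_at)
    show "at_point.maps_to (- b) (- a) (conic_slope A B V W)
        ((1 + a * b * 0) * (1 + 0^2) + 0 * (a^2 + b^2) * 0)"
      unfolding conic_slope_def by (intro at_point_intros at_V at_W)
  qed simp
  have "subst.maps_to (rconst c * V, W) t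
      (- conic_const A B (rconst c * V / rconst c) W / conic_slope A B (rconst c * V / rconst c) W)"
    unfolding t_def
    by (rule subst.maps_to_divide;
        (unfold conic_const_def conic_slope_def, intro subst_intros subst_numeral c)?)
       (use slope in \<open>simp only: cV flip: conic_slope_def, simp\<close>)
  then have t: "subst.maps_to (rconst c * V, W) t (x - A)"
    unfolding cV using conic_chord [OF D_nonzero E_nonzero xA_nonzero V_def W_def slope] by simp
  have "rsubst (A + t) (rconst c * V, W) = A + (x - A)"
    by (rule rsubst_eqI) (intro subst_intros t)
  moreover have "rsubst (y * t - B) (rconst c * V, W) = W * (x - A) - B"
    by (rule rsubst_eqI) (intro subst_intros t)
  moreover have "W * (x - A) - B = y"
    using xA_nonzero by (simp add: W_def)
  ultimately show "ratmap_comp H (vw c) = ratmap_id"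
    by (simp add: ratmap_comp_def H_def vw_def ratmap_id_def)
  have at_slope: "at_point.maps_to 0 0 (conic_slope A B (x / rconst c) y)
      (conic_slope a b (0 / c) 0)"
    unfolding conic_slope_def using assms by (intro at_point_intros)
  have slope': "conic_slope A B (x / rconst c) y \<noteq> 0"
    using at_slope by (rule nonzero_if_nonzero_at) (simp add: conic_slope_def)
  have at_const: "at_point.maps_to 0 0 (conic_const A B (x / rconst c) y) (conic_const a b (0 / c) 0)"
    unfolding conic_const_def using assms by (intro at_point_intros at_point_numeral)
  have "at_point.maps_to 0 0 t (- conic_const a b (0 / c) 0 / conic_slope a b (0 / c) 0)"
    unfolding t_def by (intro at_point_intros at_slope at_const) (simp add: conic_slope_def)
  \<comment> \<open>The origin of the (v, w) plane corresponds to the point (-a, -b) of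
    \<open>at_V\<close>.\<close>
  then have at_t: "at_point.maps_to 0 0 t (- 2 * a)"
    by (simp add: conic_slope_def conic_const_def)
  have t0: "t \<noteq> 0"
    using at_t by (rule nonzero_if_nonzero_at) (use a0 in simp)
  have YE: "A * (A + t) + B * (y * t - B) \<noteq> 0"
  proof (rule nonzero_if_nonzero_at)
    show "at_point.maps_to 0 0 (A * (A + t) + B * (y * t - B))
        (a * (a + - 2 * a) + b * (0 * (- 2 * a) - b))"
      by (intro at_point_intros at_t)
    have "a * (a + - 2 * a) + b * (0 * (- 2 * a) - b) = - (a^2 + b^2)"
      by (simp add: power2_eq_square)
    then show "a * (a + - 2 * a) + b * (0 * (- 2 * a) - b) \<noteq> 0"
      using h0 by (simp only: neg_equal_0_iff_equal not_False_eq_True)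
  qed
  have YD: "B * (A + t) + A * (y * t - B) \<noteq> 0"
  proof (rule nonzero_if_nonzero_at)
    show "at_point.maps_to 0 0 (B * (A + t) + A * (y * t - B))
        (b * (a + - 2 * a) + a * (0 * (- 2 * a) - b))"
      by (intro at_point_intros at_t)
  qed (use a0 b0 in simp)
  have "rsubst (rconst c * V) (A + t, y * t - B) =
      rconst c * ((A^2 + B^2 - (A + t)^2 - (y * t - B)^2) /
        ((A * (A + t) + B * (y * t - B)) * (B * (A + t) + A * (y * t - B))))"
    unfolding V_def by (rule rsubst_eqI, intro subst_intros) (use YE YD in simp)
  also have "\<dots> = x"
    unfolding conic_param [OF slope' t_def YE YD] using c by simp
  finally have 1: "rsubst (rconst c * V) (A + t, y * t - B) = x" .
  have "rsubst W (A + t, y * t - B) = (y * t - B + B) / (A + t - A)"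
    unfolding W_def by (rule rsubst_eqI, intro subst_intros) (use t0 in simp)
  also have "\<dots> = y" using t0 by simp
  finally have 2: "rsubst W (A + t, y * t - B) = y" .
  show "ratmap_comp (vw c) H = ratmap_id"
    by (simp add: ratmap_comp_def H_def vw_def ratmap_id_def 1 2)
qed

end

end

lemma Fract_linear: "Fract [:[:r, s:]:] 1 = rconst s * coord1 + rconst r"
proof -
  have "[:[:r, s:]:] = pconst s * px + pconst r" by (simp add: pconst_def px_def)
  then show ?thesis by (simp add: to_fract_simps flip: to_fract_def)
qed

lemma riccati_cascade_riccati_map:
  assumes "\<alpha> \<noteq> 0" "\<beta> \<noteq> 0" "\<alpha>^2 + \<beta>^2 \<noteq> 0"
  shows "riccati_cascade (riccati_map \<alpha> \<beta>)"
  unfolding riccati_cascade_def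
proof (intro conjI exI)
  \<comment> \<open>The determinant of the Moebius map in v; it is nonzero exactly because alpha^2 +
    beta^2 and alpha beta are.\<close>
  have "- 2 * \<alpha>^2 * \<beta>^2 * (2 * \<alpha>^2 * \<beta>^2) - (\<alpha>^2 - \<beta>^2) * (\<alpha>^2 * \<beta>^2 * (\<alpha>^2 - \<beta>^2)) =
      - (\<alpha>^2 * \<beta>^2 * (\<alpha>^2 + \<beta>^2)^2)"
    by algebra
  then show "- 2 * \<alpha>^2 * \<beta>^2 * (2 * \<alpha>^2 * \<beta>^2) - (\<alpha>^2 - \<beta>^2) * (\<alpha>^2 * \<beta>^2 * (\<alpha>^2 - \<beta>^2)) \<noteq> 0"
    using assms by simp
  show "fst (riccati_map \<alpha> \<beta>) =
      (rconst (- 2 * \<alpha>^2 * \<beta>^2) * coord1 + rconst (\<alpha>^2 - \<beta>^2)) /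
      (rconst (\<alpha>^2 * \<beta>^2 * (\<alpha>^2 - \<beta>^2)) * coord1 + rconst (2 * \<alpha>^2 * \<beta>^2))"
    by (simp add: riccati_map_def Let_def rconst_simps rconst_numeral algebra_simps)
  let ?A = "[:2 * \<alpha>, \<alpha> * (\<alpha>^2 - \<beta>^2):]" and ?B = "[:2 * \<beta>, \<alpha> * (\<alpha> + \<beta>)^2:]"
    and ?C = "[:- 2 * \<alpha>, - (\<alpha> * (\<alpha>^2 - \<beta>^2)):]" and ?D = "[:2 * \<beta>, - (\<alpha> * (\<alpha> - \<beta>)^2):]"
  \<comment> \<open>At v = 0 the determinant of the equation for w is 8 alpha beta.\<close>
  have "poly (?A * ?D - ?B * ?C) 0 \<noteq> 0" using assms by simp
  then show "?A * ?D - ?B * ?C \<noteq> 0" by (metis poly_0)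
  show "snd (riccati_map \<alpha> \<beta>) = (Fract [:?A:] 1 * coord2 + Fract [:?B:] 1) /
      (Fract [:?C:] 1 * coord2 + Fract [:?D:] 1)"
    unfolding Fract_linear
    by (simp add: riccati_map_def Let_def rconst_simps rconst_numeral algebra_simps)
qed

text \<open>The claims on (v, w) are conditional because v is constant for alpha^2 + beta^2 = 0, as
  \<open>vw_map_degenerate\<close> shows.\<close>

theorem mainTheorem2:
  fixes \<alpha> \<beta> \<delta> :: complex
  assumes "\<alpha> * \<beta> * \<delta> \<noteq> 0" and "\<alpha>^2 \<noteq> \<beta>^2"
  shows "birational (phi_map \<alpha> \<beta> \<delta>) \<and>
         (\<forall>n\<ge>1. ratmap_degree (ratmap_iter (phi_map \<alpha> \<beta> \<delta>) n) = 2 * n) \<and>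
         (\<alpha>^2 + \<beta>^2 \<noteq> 0 \<longrightarrow>
           birational (vw_map \<alpha> \<beta> \<delta>) \<and>
           ratmap_comp (vw_map \<alpha> \<beta> \<delta>) (phi_map \<alpha> \<beta> \<delta>)
             = ratmap_comp (riccati_map \<alpha> \<beta>) (vw_map \<alpha> \<beta> \<delta>) \<and>
           riccati_cascade (riccati_map \<alpha> \<beta>))"
proof -
  have nz: "\<alpha> \<noteq> 0" "\<beta> \<noteq> 0" "\<delta> \<noteq> 0" using assms(1) by auto
  \<comment> \<open>Chosen such that alpha = (a + b) / delta and beta = (b - a) / delta;
    \<open>c\<close> is the ratio of v to \<open>V\<close>.\<close>
  define a b c where "a = \<delta> * (\<alpha> - \<beta>) / 2" and "b = \<delta> * (\<alpha> + \<beta>) / 2" and "c = \<delta>^2 / 2"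
  have "b^2 - a^2 = \<delta>^2 * (\<alpha> * \<beta>)"
    unfolding a_def b_def by (simp add: field_simps power2_eq_square)
  moreover have "\<alpha> - \<beta> \<noteq> 0" "\<alpha> + \<beta> \<noteq> 0"
    using assms(2) by (auto simp: power2_eq_iff add_eq_0_iff)
  ultimately interpret orbit a b
    using nz by unfold_locales (simp_all add: a_def b_def)
  have c0: "c \<noteq> 0" using nz by (simp add: c_def)
  let ?d = "rconst \<delta>"
  have d0: "?d \<noteq> 0" and two: "(2 :: ratfun2) \<noteq> 0"
    using nz rconst_eq_0_iff [of 2] by (simp_all add: rconst_numeral)
  have "\<alpha> = (a + b) / \<delta>" "\<beta> = (b - a) / \<delta>"
    using nz by (simp_all add: a_def b_def field_simps)
  then have al: "rconst \<alpha> = (A + B) / ?d" and be: "rconst \<beta> = (B - A) / ?d"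
    by (simp_all only: rconst_divide rconst_simps)
  have c: "rconst c = ?d^2 / 2"
    by (simp add: c_def rconst_divide rconst_simps rconst_numeral)
  have phi: "phi_map \<alpha> \<beta> \<delta> = phi"
    unfolding phi_map_def Let_def phi_def phi_parameters [OF d0 two al be] ..
  have ab: "?d * (rconst \<alpha> + rconst \<beta>) / 2 = B" "?d * (rconst \<alpha> - rconst \<beta>) / 2 = A"
    by (simp_all add: a_def b_def rconst_divide rconst_simps rconst_numeral)
  have vw: "vw_map \<alpha> \<beta> \<delta> = vw c"
    unfolding vw_map_def Let_def vw_def V_def W_def v_parameters [OF d0 two al be] ab c ..
  have riccati: "riccati_map \<alpha> \<beta> = riccati c"
    unfolding riccati_map_def Let_def riccati_def c
      riccati_parameters [OF d0 two al be refl] ..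
  \<comment> \<open>Turns the condition on alpha and beta into the condition \<open>h0\<close> on
    \<open>a\<close> and \<open>b\<close>.\<close>
  have "a^2 + b^2 = c * (\<alpha>^2 + \<beta>^2)"
    unfolding a_def b_def c_def by (simp add: field_simps power2_eq_square)
  then have h: "a^2 + b^2 \<noteq> 0" if "\<alpha>^2 + \<beta>^2 \<noteq> 0" using that c0 by simp
  show ?thesis
    using birational_phi ratmap_degree_iter_phi birational_vw [OF h c0] vw_comp_phi [OF h c0]
      riccati_cascade_riccati_map [OF nz(1,2)]
    unfolding phi vw riccati by blast
qed

end
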